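(* Let $\mathcal{X}$ be a Polish space, $X=(X_n)_{n\ge1}$ an $\mathcal{X}$-valued process, and $\mathcal{H}$ a scalar-valued reproducing kernel Hilbert space (RKHS) of measurable functions on $\mathcal{X}$ with bounded kernel $k$. Let $P$ be a random measure on $\mathcal{X}$. If $X$ is empirically weakly converging (EWC) in probability (resp. almost surely) with limit measure $P$, then $$\lim_{n\to\infty}\frac1n\sum_{i=1}^n k(\cdot,X_i)=\int_{\mathcal{X}}k(\cdot,x)\,\mathrm{d}P(x)=:\mu_P,\qquad(\ast)$$ where the convergence (in the norm of $\mathcal{H}$) is in probability (resp. almost sure). Conversely, if the maximum mean discrepancy $$\mathrm{MMD}:(Q,R)\in\mathcal{P}(\mathcal{X})^2\mapsto\lVert\mu_Q-\mu_R\rVert_{\mathcal{H}}$$ metrizes weak convergence in $\mathcal{P}(\mathcal{X})$, then $(\ast)$ in probability (resp. almost surely) implies that $X$ is EWC in probability (resp. almost surely).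
   Context: All random variables are defined on a complete standard Borel probability space $(\Omega,\mathcal{A},\mathbb{P})$. Polish spaces carry their Borel $\sigma$-algebra. $\mathcal{P}(\mathcal{X})$ is the set of Borel probability measures on $\mathcal{X}$ with the topology of weak convergence (which is metrizable). A random measure on $\mathcal{X}$ is a measurable map $P:\Omega\to\mathcal{P}(\mathcal{X})$. The empirical measure of a process $X$ is $\eta_n^X=\frac1n\sum_{i=1}^n\delta_{X_i}$. For $Q\in\mathcal{P}(\mathcal{X})$, $\mu_Q=\int_{\mathcal{X}}k(\cdot,x)\,\mathrm{d}Q(x)\in\mathcal{H}$ is the kernel mean embedding of $Q$. The kernel $k$ is bounded if $\sup_{x\in\mathcal{X}}\sqrt{k(x,x)}<\infty$. Definition (EWC): let $d$ be a metric on $\mathcal{P}(\mathcal{X})$ that metrizes weak convergence. An $\mathcal{X}$-valued process $X$ is EWC in probability (resp. almost surely) if there exists a random measure $P$ on $\mathcal{X}$ such that $\lim_{n\to\infty}d(\eta_n^X,P)=0$ in probability (resp. almost surely); $P$ is then called a limit measure of $X$.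
   Formalization: In the first implication (EWC implies (∗)) the kernel k is additionally assumed jointly continuous; without it the claim fails, e.g. k(x,y)=1[x=0]1[y=0] on R with X_n=1/n and P=δ_0. The converse is proved without this assumption. *)

theory Defs
  imports "HOL-Probability.Probability"
begin

section \<open>Complete standard Borel probability spaces\<close>

definition standard_borel :: "'w measure \<Rightarrow> bool" where
  "standard_borel N \<longleftrightarrow>
     (\<exists>T. completely_metrizable_space T \<and> second_countable T \<and> topspace T = space N \<and>
          sets N = sigma_sets (space N) {U. openin T U})"

text \<open>The Borel sigma-algebra of an uncountable Polish space is not complete for an atomless
  measure, so \<open>complete standard Borel\<close> means: the completion of a standard Borel
  probability space.\<close>

definition complete_standard_borel_prob :: "'w measure \<Rightarrow> bool" where
  "complete_standard_borel_prob M \<longleftrightarrow>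
     (\<exists>N. prob_space N \<and> standard_borel N \<and> M = completion N)"


section \<open>The space of probability measures and its weak topology\<close>

abbreviation prob_measures :: "'a::topological_space measure set" where
  "prob_measures \<equiv> space (prob_algebra borel)"

definition weak_topology :: "'a::topological_space measure topology" where
  "weak_topology = topology_generated_by
     {{Q \<in> prob_measures. (\<integral>x. f x \<partial>Q) \<in> U} | (f :: 'a \<Rightarrow> real) U.
        continuous_on UNIV f \<and> bounded (range f) \<and> open U}"

text \<open>The locale \<^locale>\<open>Metric_space\<close> demands nonnegativity and symmetry on the whole type,
  not only on the carrier. Distances are therefore cut off outside the carrier, so that only
  their values on the carrier matter.\<close>

definition on_carrier :: "'b set \<Rightarrow> ('b \<Rightarrow> 'b \<Rightarrow> real) \<Rightarrow> 'b \<Rightarrow> 'b \<Rightarrow> real" where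
  "on_carrier A d = (\<lambda>x y. if x \<in> A \<and> y \<in> A then d x y else 0)"

definition metrizes_weak_convergence ::
    "('a::topological_space measure \<Rightarrow> 'a measure \<Rightarrow> real) \<Rightarrow> bool" where
  "metrizes_weak_convergence d \<longleftrightarrow>
     Metric_space prob_measures (on_carrier prob_measures d) \<and>
     Metric_space.mtopology prob_measures (on_carrier prob_measures d) = weak_topology"

text \<open>For Polish spaces, \<^term>\<open>prob_algebra borel\<close> carries the Borel sigma-algebra of the weak
  topology.\<close>

definition random_measure :: "'w measure \<Rightarrow> ('w \<Rightarrow> 'a::topological_space measure) \<Rightarrow> bool" where
  "random_measure M P \<longleftrightarrow> P \<in> measurable M (prob_algebra borel)"


section \<open>Convergence in probability, empirical measures, and EWC processes\<close>

text \<open>Sequences are indexed by \<open>n \<ge> 1\<close>; the value at 0 is irrelevant. Without the measurability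
  clause, non-measurable events would silently have measure 0.\<close>

definition tendsto_zero_in_prob :: "'w measure \<Rightarrow> (nat \<Rightarrow> 'w \<Rightarrow> real) \<Rightarrow> bool" where
  "tendsto_zero_in_prob M Y \<longleftrightarrow>
     (\<forall>n\<ge>1. Y n \<in> borel_measurable M) \<and>
     (\<forall>\<epsilon>>0. (\<lambda>n. measure M {\<omega> \<in> space M. \<bar>Y n \<omega>\<bar> > \<epsilon>}) \<longlonglongrightarrow> 0)"

definition tendsto_zero_as :: "'w measure \<Rightarrow> (nat \<Rightarrow> 'w \<Rightarrow> real) \<Rightarrow> bool" where
  "tendsto_zero_as M Y \<longleftrightarrow> (AE \<omega> in M. (\<lambda>n. Y n \<omega>) \<longlonglongrightarrow> 0)"

definition empirical_measure ::
    "(nat \<Rightarrow> 'w \<Rightarrow> 'a::topological_space) \<Rightarrow> nat \<Rightarrow> 'w \<Rightarrow> 'a measure" where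
  "empirical_measure X n \<omega> =
     measure_of UNIV (sets borel)
       (\<lambda>A. (\<Sum>i=1..n. emeasure (return borel (X i \<omega>)) A) / of_nat n)"

definition ewc_in_prob_with_limit ::
    "'w measure \<Rightarrow> ('a::topological_space measure \<Rightarrow> 'a measure \<Rightarrow> real) \<Rightarrow>
     (nat \<Rightarrow> 'w \<Rightarrow> 'a) \<Rightarrow> ('w \<Rightarrow> 'a measure) \<Rightarrow> bool" where
  "ewc_in_prob_with_limit M d X P \<longleftrightarrow>
     random_measure M P \<and>
     tendsto_zero_in_prob M (\<lambda>n \<omega>. d (empirical_measure X n \<omega>) (P \<omega>))"

definition ewc_as_with_limit ::
    "'w measure \<Rightarrow> ('a::topological_space measure \<Rightarrow> 'a measure \<Rightarrow> real) \<Rightarrow>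
     (nat \<Rightarrow> 'w \<Rightarrow> 'a) \<Rightarrow> ('w \<Rightarrow> 'a measure) \<Rightarrow> bool" where
  "ewc_as_with_limit M d X P \<longleftrightarrow>
     random_measure M P \<and>
     tendsto_zero_as M (\<lambda>n \<omega>. d (empirical_measure X n \<omega>) (P \<omega>))"

definition ewc_in_prob ::
    "'w measure \<Rightarrow> ('a::topological_space measure \<Rightarrow> 'a measure \<Rightarrow> real) \<Rightarrow>
     (nat \<Rightarrow> 'w \<Rightarrow> 'a) \<Rightarrow> bool" where
  "ewc_in_prob M d X \<longleftrightarrow> (\<exists>P. ewc_in_prob_with_limit M d X P)"

definition ewc_as ::
    "'w measure \<Rightarrow> ('a::topological_space measure \<Rightarrow> 'a measure \<Rightarrow> real) \<Rightarrow>
     (nat \<Rightarrow> 'w \<Rightarrow> 'a) \<Rightarrow> bool" where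
  "ewc_as M d X \<longleftrightarrow> (\<exists>P. ewc_as_with_limit M d X P)"


section \<open>Reproducing kernel Hilbert spaces\<close>

definition rkhs_norm :: "(('a \<Rightarrow> real) \<Rightarrow> ('a \<Rightarrow> real) \<Rightarrow> real) \<Rightarrow> ('a \<Rightarrow> real) \<Rightarrow> real" where
  "rkhs_norm ip f = sqrt (ip f f)"

text \<open>A real Hilbert space \<open>H\<close> of functions, with inner product \<open>ip\<close> and reproducing kernel \<open>k\<close>.
  Here \<open>\<lambda>y. k y x\<close> is the function written \<open>k(\<cdot>, x)\<close>.\<close>

locale rkhs =
  fixes H :: "('a \<Rightarrow> real) set"
    and ip :: "('a \<Rightarrow> real) \<Rightarrow> ('a \<Rightarrow> real) \<Rightarrow> real"
    and k :: "'a \<Rightarrow> 'a \<Rightarrow> real"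
  assumes zero_mem: "(\<lambda>x. 0) \<in> H"
    and add_mem: "\<lbrakk>f \<in> H; g \<in> H\<rbrakk> \<Longrightarrow> (\<lambda>x. f x + g x) \<in> H"
    and scale_mem: "f \<in> H \<Longrightarrow> (\<lambda>x. c * f x) \<in> H"
    and ip_commute: "\<lbrakk>f \<in> H; g \<in> H\<rbrakk> \<Longrightarrow> ip f g = ip g f"
    and ip_add_left: "\<lbrakk>f \<in> H; g \<in> H; h \<in> H\<rbrakk> \<Longrightarrow> ip (\<lambda>x. f x + g x) h = ip f h + ip g h"
    and ip_scale_left: "\<lbrakk>f \<in> H; g \<in> H\<rbrakk> \<Longrightarrow> ip (\<lambda>x. c * f x) g = c * ip f g"
    and ip_nonneg: "f \<in> H \<Longrightarrow> ip f f \<ge> 0"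
    and ip_eq_zero: "\<lbrakk>f \<in> H; ip f f = 0\<rbrakk> \<Longrightarrow> f = (\<lambda>x. 0)"
    and complete:
      "Metric_space.mcomplete H (on_carrier H (\<lambda>f g. rkhs_norm ip (\<lambda>x. f x - g x)))"
    and kernel_mem: "(\<lambda>y. k y x) \<in> H"
    and reproducing: "f \<in> H \<Longrightarrow> ip f (\<lambda>y. k y x) = f x"

definition bounded_kernel :: "('a \<Rightarrow> 'a \<Rightarrow> real) \<Rightarrow> bool" where
  "bounded_kernel k \<longleftrightarrow> bdd_above (range (\<lambda>x. sqrt (k x x)))"

text \<open>Boundedness and measurability of \<open>k\<close> do not make \<open>Q \<mapsto> \<mu>\<^sub>Q\<close> continuous for the weak topology:
  for \<open>k x y = 1\<close> if \<open>x = y = 0\<close> and \<open>k x y = 0\<close> otherwise, on the reals, the embeddings of the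
  empirical measures of \<open>X\<^sub>n = 1/n\<close> vanish, while that of their weak limit, the Dirac measure at 0,
  has norm 1. Continuity of \<open>k\<close> suffices.\<close>

definition continuous_kernel :: "('a::topological_space \<Rightarrow> 'a \<Rightarrow> real) \<Rightarrow> bool" where
  "continuous_kernel k \<longleftrightarrow> continuous_on UNIV (\<lambda>(x, y). k x y)"

text \<open>The \<open>H\<close>-valued integral of \<open>x \<mapsto> k(\<cdot>, x)\<close> against \<open>Q\<close>, taken in the weak (Pettis) sense. It is
  the Bochner integral whenever the latter exists, but, for a bounded kernel and a space of
  measurable functions, it needs no separability of \<open>H\<close>.\<close>

definition kernel_mean_embedding ::
    "('a \<Rightarrow> real) set \<Rightarrow> (('a \<Rightarrow> real) \<Rightarrow> ('a \<Rightarrow> real) \<Rightarrow> real) \<Rightarrow> ('a \<Rightarrow> 'a \<Rightarrow> real) \<Rightarrow>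
     'a measure \<Rightarrow> 'a \<Rightarrow> real" where
  "kernel_mean_embedding H ip k Q =
     (THE h. h \<in> H \<and> (\<forall>f\<in>H. ip f h = (\<integral>x. ip f (\<lambda>y. k y x) \<partial>Q)))"

definition mmd ::
    "('a \<Rightarrow> real) set \<Rightarrow> (('a \<Rightarrow> real) \<Rightarrow> ('a \<Rightarrow> real) \<Rightarrow> real) \<Rightarrow> ('a \<Rightarrow> 'a \<Rightarrow> real) \<Rightarrow>
     'a measure \<Rightarrow> 'a measure \<Rightarrow> real" where
  "mmd H ip k Q R =
     rkhs_norm ip (\<lambda>y. kernel_mean_embedding H ip k Q y - kernel_mean_embedding H ip k R y)"

definition embedding_error ::
    "('a \<Rightarrow> real) set \<Rightarrow> (('a \<Rightarrow> real) \<Rightarrow> ('a \<Rightarrow> real) \<Rightarrow> real) \<Rightarrow> ('a \<Rightarrow> 'a \<Rightarrow> real) \<Rightarrow>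
     (nat \<Rightarrow> 'w \<Rightarrow> 'a) \<Rightarrow> ('w \<Rightarrow> 'a measure) \<Rightarrow> nat \<Rightarrow> 'w \<Rightarrow> real" where
  "embedding_error H ip k X P n \<omega> =
     rkhs_norm ip (\<lambda>y. (1 / real n) * (\<Sum>i=1..n. k y (X i \<omega>))
                       - kernel_mean_embedding H ip k (P \<omega>) y)"

end

theory Submission
  imports Defs
begin

text \<open>Weak convergence implies convergence of the mean embeddings: the functions in the unit ball of
  \<open>H\<close> are uniformly bounded and equicontinuous for the kernel distance
  \<open>\<lambda>x y. rkhs_norm ip (\<lambda>z. k z x - k z y)\<close>, which is continuous. Cutting the space with a partition of
  unity subordinate to small balls of this distance, the embedding of \<open>Q\<close> is close to a finite
  combination of kernel functions whose coefficients are integrals of bounded continuous functions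
  against \<open>Q\<close>. Conversely, if the maximum mean discrepancy metrizes weak convergence, then the kernel
  is continuous, because Dirac measures depend continuously on their atom.

  Convergence in probability is reduced to almost sure convergence along subsequences. This needs
  measurability of the distance between the empirical and the limit measure. For the discrepancy it
  follows from a formula with double integrals of \<open>k\<close>; any other metric of weak convergence inherits it,
  since the space of measures is separable for the discrepancy, so that weakly open sets are countable
  unions of discrepancy balls.\<close>

section \<open>Riesz representation in a reproducing kernel Hilbert space\<close>

context rkhs
begin

abbreviation nrm :: "('a \<Rightarrow> real) \<Rightarrow> real" where
  "nrm \<equiv> rkhs_norm ip"

section \<open>Inner product identities, norm inequalities and completeness of
  \<open>H\<close>\<close>

lemma diff_mem: "f \<in> H \<Longrightarrow> g \<in> H \<Longrightarrow> (\<lambda>x. f x - g x) \<in> H"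
  using add_mem[of f "\<lambda>x. -1 * g x"] scale_mem[of g "-1"] by simp

lemma ip_add_right: "\<lbrakk>f \<in> H; g \<in> H; h \<in> H\<rbrakk> \<Longrightarrow> ip h (\<lambda>x. f x + g x) = ip h f + ip h g"
  using ip_add_left[of f g h] ip_commute[OF add_mem, of f g h] ip_commute[of f h] ip_commute[of g h] by simp

lemma ip_scale_right: "\<lbrakk>f \<in> H; g \<in> H\<rbrakk> \<Longrightarrow> ip g (\<lambda>x. c * f x) = c * ip g f"
  using ip_scale_left[of f g c] ip_commute[OF scale_mem, of f g c] ip_commute[of f g] by simp

lemma ip_diff_left: "\<lbrakk>f \<in> H; g \<in> H; h \<in> H\<rbrakk> \<Longrightarrow> ip (\<lambda>x. f x - g x) h = ip f h - ip g h"
  using ip_add_left[of f "\<lambda>x. -1 * g x" h] scale_mem[of g "-1"] ip_scale_left[of g h "-1"] by simp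

lemma ip_diff_right: "\<lbrakk>f \<in> H; g \<in> H; h \<in> H\<rbrakk> \<Longrightarrow> ip h (\<lambda>x. f x - g x) = ip h f - ip h g"
  using ip_diff_left[of f g h] ip_commute[OF diff_mem, of f g h] ip_commute[of f h] ip_commute[of g h] by simp

lemma nrm_nonneg: "f \<in> H \<Longrightarrow> 0 \<le> nrm f"
  by (simp add: rkhs_norm_def ip_nonneg)

lemma nrm_sq: "f \<in> H \<Longrightarrow> (nrm f)\<^sup>2 = ip f f"
  by (simp add: rkhs_norm_def ip_nonneg)

lemma nrm_add_sq:
  "f \<in> H \<Longrightarrow> g \<in> H \<Longrightarrow> (nrm (\<lambda>x. f x + g x))\<^sup>2 = (nrm f)\<^sup>2 + 2 * ip f g + (nrm g)\<^sup>2"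
  by (simp add: nrm_sq add_mem ip_add_left ip_add_right ip_commute[of g f])

lemma nrm_diff_sq:
  "f \<in> H \<Longrightarrow> g \<in> H \<Longrightarrow> (nrm (\<lambda>x. f x - g x))\<^sup>2 = (nrm f)\<^sup>2 - 2 * ip f g + (nrm g)\<^sup>2"
  by (simp add: nrm_sq diff_mem ip_diff_left ip_diff_right ip_commute[of g f])

lemma nrm_zero: "nrm (\<lambda>x. 0) = 0"
  using ip_scale_left[OF zero_mem zero_mem, of 0] by (simp add: rkhs_norm_def)

lemma ip_zero_right: "f \<in> H \<Longrightarrow> ip f (\<lambda>x. 0) = 0"
  using ip_scale_right[OF zero_mem, of f 0] by simp

lemma nrm_scale: "f \<in> H \<Longrightarrow> nrm (\<lambda>x. c * f x) = \<bar>c\<bar> * nrm f"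
  by (simp add: rkhs_norm_def ip_scale_left ip_scale_right scale_mem real_sqrt_mult flip: mult.assoc)

lemma nrm_diff_commute: "f \<in> H \<Longrightarrow> g \<in> H \<Longrightarrow> nrm (\<lambda>x. f x - g x) = nrm (\<lambda>x. g x - f x)"
  using nrm_scale[of "\<lambda>x. f x - g x" "-1"] by (simp add: diff_mem)

lemma Cauchy_Schwarz:
  assumes f: "f \<in> H" and g: "g \<in> H"
  shows "\<bar>ip f g\<bar> \<le> nrm f * nrm g"
proof (cases "ip g g = 0")
  case True
  then have "g = (\<lambda>x. 0)" using ip_eq_zero g by blast
  then show ?thesis using f by (simp add: ip_zero_right nrm_zero)
next
  case False
  then have pos: "ip g g > 0" using ip_nonneg[OF g] by linarith
  \<comment> \<open>\<open>t\<close> is the coefficient of the orthogonal projection of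
    \<open>f\<close> onto \<open>g\<close>, which minimises the norm of the remainder.\<close>
  define t where "t = ip f g / ip g g"
  have "0 \<le> (nrm (\<lambda>x. f x - t * g x))\<^sup>2" by simp
  also have "\<dots> = ip f f - 2 * t * ip f g + t\<^sup>2 * ip g g"
    by (subst nrm_diff_sq[OF f scale_mem[OF g]])
       (simp add: nrm_scale f g ip_scale_right scale_mem power_mult_distrib nrm_sq)
  also have "\<dots> = ip f f - (ip f g)\<^sup>2 / ip g g"
    using pos by (simp add: t_def power2_eq_square field_simps)
  finally have "(ip f g)\<^sup>2 \<le> ip f f * ip g g"
    using pos by (simp add: field_simps)
  also have "\<dots> = (nrm f * nrm g)\<^sup>2"
    by (simp add: power_mult_distrib nrm_sq f g)
  finally show ?thesis
    using abs_le_square_iff[of "ip f g" "nrm f * nrm g"] nrm_nonneg[OF f] nrm_nonneg[OF g] by simp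
qed

lemma nrm_triangle:
  assumes f: "f \<in> H" and g: "g \<in> H"
  shows "nrm (\<lambda>x. f x + g x) \<le> nrm f + nrm g"
proof (rule power2_le_imp_le)
  show "(nrm (\<lambda>x. f x + g x))\<^sup>2 \<le> (nrm f + nrm g)\<^sup>2"
    using Cauchy_Schwarz[OF f g] by (simp add: nrm_add_sq f g power2_sum)
  show "0 \<le> nrm f + nrm g" using nrm_nonneg f g by auto
qed

lemma nrm_diff_triangle:
  assumes "f \<in> H" "g \<in> H" "h \<in> H"
  shows "nrm (\<lambda>x. f x - h x) \<le> nrm (\<lambda>x. f x - g x) + nrm (\<lambda>x. g x - h x)"
  using nrm_triangle[of "\<lambda>x. f x - g x" "\<lambda>x. g x - h x"] assms by (simp add: diff_mem)

lemma nrm_eq_zero: "f \<in> H \<Longrightarrow> nrm f = 0 \<Longrightarrow> f = (\<lambda>x. 0)"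
  by (simp add: rkhs_norm_def ip_eq_zero)

lemma Metric_space_H:
  "Metric_space H (on_carrier H (\<lambda>f g. nrm (\<lambda>x. f x - g x)))"
proof
  fix f g h
  show "0 \<le> on_carrier H (\<lambda>f g. nrm (\<lambda>x. f x - g x)) f g"
    by (simp add: on_carrier_def nrm_nonneg diff_mem)
  show "on_carrier H (\<lambda>f g. nrm (\<lambda>x. f x - g x)) f g = on_carrier H (\<lambda>f g. nrm (\<lambda>x. f x - g x)) g f"
    using nrm_diff_commute[of f g] by (simp add: on_carrier_def)
  show "on_carrier H (\<lambda>f g. nrm (\<lambda>x. f x - g x)) f g = 0 \<longleftrightarrow> f = g" if "f \<in> H" "g \<in> H"
    using nrm_eq_zero[OF diff_mem[OF that]] that
    by (auto simp: on_carrier_def nrm_zero fun_eq_iff)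
  show "on_carrier H (\<lambda>f g. nrm (\<lambda>x. f x - g x)) f h
      \<le> on_carrier H (\<lambda>f g. nrm (\<lambda>x. f x - g x)) f g + on_carrier H (\<lambda>f g. nrm (\<lambda>x. f x - g x)) g h"
    if "f \<in> H" "g \<in> H" "h \<in> H"
    using that by (simp add: on_carrier_def nrm_diff_triangle)
qed

text \<open>Frees completeness from the cut-off distance in which the locale states it: all terms
  lie in \<open>H\<close>, so the cut-off is invisible.\<close>

lemma Cauchy_convergent:
  assumes s: "\<And>n. s n \<in> H"
    and C: "\<And>e. e > 0 \<Longrightarrow> \<exists>N. \<forall>m\<ge>N. \<forall>n\<ge>N. nrm (\<lambda>x. s m x - s n x) < e"
  obtains f where "f \<in> H" "(\<lambda>n. nrm (\<lambda>x. s n x - f x)) \<longlonglongrightarrow> 0"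
proof -
  interpret Metric_space H "on_carrier H (\<lambda>f g. nrm (\<lambda>x. f x - g x))" by (rule Metric_space_H)
  have "range s \<subseteq> H \<and> (\<forall>e>0. \<exists>N. \<forall>n n'. N \<le> n \<longrightarrow> N \<le> n' \<longrightarrow>
      (if s n \<in> H \<and> s n' \<in> H then nrm (\<lambda>x. s n x - s n' x) else 0) < e)"
  proof (intro conjI allI impI)
    fix e :: real assume "e > 0"
    then obtain N where "\<forall>m\<ge>N. \<forall>n\<ge>N. nrm (\<lambda>x. s m x - s n x) < e" using C by blast
    then show "\<exists>N. \<forall>n n'. N \<le> n \<longrightarrow> N \<le> n' \<longrightarrow>
        (if s n \<in> H \<and> s n' \<in> H then nrm (\<lambda>x. s n x - s n' x) else 0) < e"
      using s by (intro exI[of _ N]) simp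
  qed (use s in blast)
  then have "MCauchy s" unfolding MCauchy_def by (simp add: on_carrier_def)
  then obtain f where "limitin mtopology s f sequentially"
    using complete unfolding mcomplete_def by blast
  then have "f \<in> H" "(\<lambda>n. on_carrier H (\<lambda>f g. nrm (\<lambda>x. f x - g x)) (s n) f) \<longlonglongrightarrow> 0"
    unfolding limitin_metric_dist_null by auto
  then show ?thesis using that s by (simp add: on_carrier_def)
qed

text \<open>The representer is the minimiser of \<open>\<lambda>f. (nrm f)\<^sup>2 - 2 * L f\<close>: by the parallelogram law every
  minimising sequence is Cauchy.\<close>

lemma Riesz_representation:
  assumes add: "\<And>f g. f \<in> H \<Longrightarrow> g \<in> H \<Longrightarrow> L (\<lambda>x. f x + g x) = L f + L g"
    and scale: "\<And>f c. f \<in> H \<Longrightarrow> L (\<lambda>x. c * f x) = c * L f"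
    and bnd: "\<And>f. f \<in> H \<Longrightarrow> \<bar>L f\<bar> \<le> C * nrm f"
  obtains h where "h \<in> H" "\<And>f. f \<in> H \<Longrightarrow> ip f h = L f"
proof -
  define J where "J f = (nrm f)\<^sup>2 - 2 * L f" for f
  define j where "j = (INF f\<in>H. J f)"
  \<comment> \<open>Completing the square bounds \<open>J\<close> below, so that the infimum
    \<open>j\<close> is a true lower bound.\<close>
  have low: "- C\<^sup>2 \<le> J f" if "f \<in> H" for f
  proof -
    have "0 \<le> (nrm f - C)\<^sup>2" by simp
    then show ?thesis using bnd[OF that] by (simp add: J_def power2_diff) argo
  qed
  have bdd: "bdd_below (J ` H)" using low by (auto intro!: bdd_belowI)
  have j_le: "j \<le> J f" if "f \<in> H" for f
    unfolding j_def using bdd that by (rule cINF_lower)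
  have "\<exists>f\<in>H. J f < j + 1 / real (Suc n)" for n
  proof -
    have "(INF f\<in>H. J f) < j + 1 / real (Suc n)" by (simp add: j_def)
    then show ?thesis using cInf_lessD[of "J ` H"] zero_mem by blast
  qed
  then obtain s where s: "\<And>n. s n \<in> H" "\<And>n. J (s n) < j + 1 / real (Suc n)" by metis
  have near: "(nrm (\<lambda>x. f x - g x))\<^sup>2 \<le> 2 * (J f - j) + 2 * (J g - j)" if f: "f \<in> H" and g: "g \<in> H" for f g
  proof -
    \<comment> \<open>The midpoint of \<open>f\<close> and \<open>g\<close> has a
      \<open>J\<close>-value of at least \<open>j\<close>; by the parallelogram law two
      near-minimisers are then close to each other.\<close>
    have m: "(\<lambda>x. (1/2) * (f x + g x)) \<in> H" by (intro scale_mem add_mem f g)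
    have "J (\<lambda>x. (1/2) * (f x + g x)) = (1/4) * (nrm (\<lambda>x. f x + g x))\<^sup>2 - (L f + L g)"
      by (simp only: J_def nrm_scale[OF add_mem[OF f g]] scale[OF add_mem[OF f g]] add[OF f g])
         (simp add: power_mult_distrib power2_eq_square field_simps)
    with j_le[OF m] have "j \<le> (1/4) * (nrm (\<lambda>x. f x + g x))\<^sup>2 - (L f + L g)" by linarith
    then show ?thesis
      unfolding J_def nrm_diff_sq[OF f g] nrm_add_sq[OF f g] by argo
  qed
  have "\<exists>N. \<forall>m\<ge>N. \<forall>n\<ge>N. nrm (\<lambda>x. s m x - s n x) < e" if "e > 0" for e
  proof -
    \<comment> \<open>From \<open>N\<close> on, each excess \<open>J (s i) - j\<close> is below a
      quarter of the square of \<open>e\<close>, and \<open>near\<close> counts both excesses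
      twice.\<close>
    obtain N where N: "1 / real (Suc N) < e\<^sup>2 / 4"
      using reals_Archimedean[of "e\<^sup>2/4"] \<open>e > 0\<close> by (auto simp: inverse_eq_divide)
    have "nrm (\<lambda>x. s m x - s n x) < e" if "m \<ge> N" "n \<ge> N" for m n
    proof (rule power2_less_imp_less)
      have "1 / real (Suc i) \<le> 1 / real (Suc N)" if "i \<ge> N" for i
        using that by (simp add: frac_le)
      from this[OF \<open>m \<ge> N\<close>] this[OF \<open>n \<ge> N\<close>] N s(2)[of m] s(2)[of n] near[OF s(1) s(1), of m n]
      show "(nrm (\<lambda>x. s m x - s n x))\<^sup>2 < e\<^sup>2" by argo
    qed (use \<open>e > 0\<close> in simp)
    then show ?thesis by blast
  qed
  then obtain h where h: "h \<in> H" and lim: "(\<lambda>n. nrm (\<lambda>x. s n x - h x)) \<longlonglongrightarrow> 0"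
    using Cauchy_convergent[of s] s(1) by blast
  have L_diff: "L f - L g = L (\<lambda>x. f x - g x)" if "f \<in> H" "g \<in> H" for f g
    using add[of f "\<lambda>x. -1 * g x"] scale[of g "-1"] scale_mem[of g "-1"] that by simp
  \<comment> \<open>A one-sided estimate at \<open>h\<close> is enough to compare \<open>J h\<close>
    with the limit of the minimising sequence, so the squared distance in the expansion around
    \<open>h\<close> is simply dropped.\<close>
  have Jdiff: "J h \<le> J f + 2 * (nrm h + C) * nrm (\<lambda>x. f x - h x)" if f: "f \<in> H" for f
  proof -
    have fh: "(\<lambda>x. f x - h x) \<in> H" by (intro diff_mem f h)
    have "(nrm f)\<^sup>2 = (nrm h)\<^sup>2 + 2 * ip h (\<lambda>x. f x - h x) + (nrm (\<lambda>x. f x - h x))\<^sup>2"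
      using nrm_add_sq[OF h fh] by simp
    moreover have "- (nrm h * nrm (\<lambda>x. f x - h x)) \<le> ip h (\<lambda>x. f x - h x)"
      using Cauchy_Schwarz[OF h fh] by linarith
    moreover have "L f - L h \<le> C * nrm (\<lambda>x. f x - h x)"
      using L_diff[OF f h] bnd[OF fh] by linarith
    moreover have "2 * (nrm h + C) * nrm (\<lambda>x. f x - h x)
        = 2 * (nrm h * nrm (\<lambda>x. f x - h x)) + 2 * (C * nrm (\<lambda>x. f x - h x))"
      by (simp add: algebra_simps)
    moreover have "0 \<le> (nrm (\<lambda>x. f x - h x))\<^sup>2" by simp
    ultimately show ?thesis unfolding J_def by argo
  qed
  have Jh: "J h \<le> j"
  proof (rule LIMSEQ_le_const)
    have "(\<lambda>n. j + 1 / real (Suc n) + 2 * (nrm h + C) * nrm (\<lambda>x. s n x - h x)) \<longlonglongrightarrow> j + 0 + 2 * (nrm h + C) * 0"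
      using LIMSEQ_inverse_real_of_nat
      by (intro tendsto_intros lim) (simp add: inverse_eq_divide)
    then show "(\<lambda>n. j + 1 / real (Suc n) + 2 * (nrm h + C) * nrm (\<lambda>x. s n x - h x)) \<longlonglongrightarrow> j" by simp
    show "\<exists>N. \<forall>n\<ge>N. J h \<le> j + 1 / real (Suc n) + 2 * (nrm h + C) * nrm (\<lambda>x. s n x - h x)"
      using Jdiff[OF s(1)] s(2) by (meson add_right_mono less_imp_le order_trans)
  qed
  have "ip f h = L f" if f: "f \<in> H" for f
  proof -
    define a where "a = ip h f - L f"
    \<comment> \<open>First variation: moving from the minimiser \<open>h\<close> along
      \<open>f\<close> cannot lower \<open>J\<close>, and \<open>2 * a\<close> is the slope at 0 of
      this quadratic in \<open>t\<close>.\<close>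
    have ineq: "0 \<le> 2 * t * a + t\<^sup>2 * (nrm f)\<^sup>2" for t
    proof -
      have "J (\<lambda>x. h x + t * f x) = J h + 2 * t * a + t\<^sup>2 * (nrm f)\<^sup>2"
        by (simp add: J_def nrm_add_sq[OF h scale_mem[OF f]] nrm_scale[OF f] ip_scale_right[OF f h]
            add[OF h scale_mem[OF f]] scale[OF f] a_def power_mult_distrib algebra_simps)
      moreover have "j \<le> J (\<lambda>x. h x + t * f x)" by (intro j_le add_mem scale_mem f h)
      ultimately show ?thesis using Jh by linarith
    qed
    have "a = 0"
    proof (rule ccontr)
      assume "a \<noteq> 0"
      \<comment> \<open>For \<open>a\<close> nonzero the step \<open>- a / q\<close> would make the
        quadratic negative; adding 1 keeps \<open>q\<close> positive also when \<open>f\<close> has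
        norm 0.\<close>
      define q where "q = (nrm f)\<^sup>2 + 1"
      have "q > 0" unfolding q_def by (smt (verit) zero_le_power2)
      have "0 \<le> 2 * (- a / q) * a + (- a / q)\<^sup>2 * (nrm f)\<^sup>2" by (rule ineq)
      also have "\<dots> \<le> 2 * (- a / q) * a + (- a / q)\<^sup>2 * q"
        by (intro add_left_mono mult_left_mono) (auto simp: q_def)
      also have "\<dots> = - (a\<^sup>2 / q)" using \<open>q > 0\<close> by (simp add: power2_eq_square field_simps)
      also have "\<dots> < 0" using \<open>q > 0\<close> \<open>a \<noteq> 0\<close> by simp
      finally show False by simp
    qed
    then show ?thesis using ip_commute[OF f h] by (simp add: a_def)
  qed
  then show ?thesis using h that by blast
qed

section \<open>Kernel functions and their finite combinations\<close>

lemma kernel_commute: "k x y = k y x"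
  using reproducing[OF kernel_mem, of y x] reproducing[OF kernel_mem, of x y]
    ip_commute[OF kernel_mem kernel_mem, of x y] by simp

lemma kernel_diag_nonneg: "0 \<le> k x x"
  using ip_nonneg[OF kernel_mem, of x] reproducing[OF kernel_mem, of x x] by simp

lemma nrm_kernel: "nrm (\<lambda>y. k y x) = sqrt (k x x)"
  by (simp add: rkhs_norm_def reproducing kernel_mem)

lemma kernel_comb_mem: "(\<lambda>y. \<Sum>i\<in>A. c i * k y (z i)) \<in> H"
  by (induction A rule: infinite_finite_induct)
     (auto intro!: zero_mem add_mem scale_mem kernel_mem)

lemma ip_kernel_comb:
  assumes f: "f \<in> H"
  shows "ip f (\<lambda>y. \<Sum>i\<in>A. c i * k y (z i)) = (\<Sum>i\<in>A. c i * f (z i))"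
  by (induction A rule: infinite_finite_induct)
     (simp_all add: f ip_zero_right ip_add_right scale_mem kernel_mem kernel_comb_mem
        ip_scale_right reproducing)

end

section \<open>Empirical measures and kernel mean embeddings\<close>

lemma integral_empirical_pmf:
  fixes f :: "'a::topological_space \<Rightarrow> real"
  assumes "n \<ge> 1" and "f \<in> borel_measurable borel"
  shows "(\<integral>x. f x \<partial>distr (measure_pmf (pmf_of_set {1..n})) borel z) = (\<Sum>i=1..n. f (z i)) / real n"
  using assms by (subst integral_distr) (auto simp: integral_pmf_of_set)

text \<open>The defining \<open>measure_of\<close> term carries no evidence that its set function is
  a measure. As an image of the uniform distribution on the indices it is visibly a probability
  measure, and integrals against it become averages.\<close>

lemma empirical_measure_eq_distr:
  assumes "n \<ge> 1"
  shows "empirical_measure X n \<omega> = distr (measure_pmf (pmf_of_set {1..n})) borel (\<lambda>i. X i \<omega>)"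
    (is "_ = ?N")
proof -
  have "(\<Sum>i=1..n. emeasure (return borel (X i \<omega>)) A) / of_nat n = emeasure ?N A"
    if A: "A \<in> sets borel" for A
  proof -
    have "emeasure ?N A = (\<integral>\<^sup>+ x. indicator A x \<partial>?N)" using A by simp
    also have "\<dots> = (\<integral>\<^sup>+ i. indicator A (X i \<omega>) \<partial>measure_pmf (pmf_of_set {1..n}))"
      using A by (intro nn_integral_distr) auto
    also have "\<dots> = (\<Sum>i=1..n. indicator A (X i \<omega>)) / of_nat n"
      using assms by (subst nn_integral_pmf_of_set) auto
    finally show ?thesis using A by simp
  qed
  \<comment> \<open>\<open>measure_of\<close> depends on the set function only through its values on
    the Borel sets.\<close>
  then have "empirical_measure X n \<omega> = measure_of UNIV (sets borel) (emeasure ?N)"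
    unfolding empirical_measure_def by (intro measure_of_eq) (auto simp: sets.sigma_sets_eq[of borel, simplified])
  also have "\<dots> = ?N" using measure_of_of_measure[of ?N] by simp
  finally show ?thesis .
qed

lemma empirical_measure_prob:
  assumes "n \<ge> 1"
  shows "empirical_measure X n \<omega> \<in> prob_measures"
  using assms by (auto simp: empirical_measure_eq_distr space_prob_algebra
      intro!: prob_space.prob_space_distr measure_pmf.prob_space_axioms)

lemma integral_empirical_measure:
  fixes f :: "'a::topological_space \<Rightarrow> real"
  assumes "n \<ge> 1" and "f \<in> borel_measurable borel"
  shows "(\<integral>x. f x \<partial>empirical_measure X n \<omega>) = (\<Sum>i=1..n. f (X i \<omega>)) / real n"
  unfolding empirical_measure_eq_distr[OF assms(1)] by (rule integral_empirical_pmf[OF assms])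

text \<open>Measurability into the space of measures is tested by evaluation at Borel sets, which
  gives finite averages of indicators of the \<open>X i\<close>.\<close>

lemma empirical_measure_measurable:
  assumes X: "\<And>i. i \<ge> 1 \<Longrightarrow> X i \<in> borel_measurable M" and n: "n \<ge> 1"
  shows "empirical_measure X n \<in> measurable M (prob_algebra borel)"
proof (intro measurable_prob_algebraI measurable_subprob_algebra)
  have P: "prob_space (empirical_measure X n \<omega>)" and S: "sets (empirical_measure X n \<omega>) = sets borel" for \<omega>
    using empirical_measure_prob[OF n, of X \<omega>] by (simp_all add: space_prob_algebra)
  show "prob_space (empirical_measure X n \<omega>)" "subprob_space (empirical_measure X n \<omega>)"
    "sets (empirical_measure X n \<omega>) = sets borel" for \<omega>
    by (rule P prob_space_imp_subprob_space[OF P] S)+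
  fix A :: "'b set" assume A: "A \<in> sets borel"
  have eq: "emeasure (empirical_measure X n \<omega>) A = ennreal ((\<Sum>i=1..n. indicator A (X i \<omega>)) / real n)" for \<omega>
  proof -
    interpret prob_space "empirical_measure X n \<omega>" by (rule P)
    have "emeasure (empirical_measure X n \<omega>) A = ennreal (\<integral>x. indicator A x \<partial>empirical_measure X n \<omega>)"
      using A by (simp add: emeasure_eq_measure S)
    also have "(\<integral>x. indicator A x \<partial>empirical_measure X n \<omega>) = (\<Sum>i=1..n. indicator A (X i \<omega>)) / real n"
      using A by (intro integral_empirical_measure n) auto
    finally show ?thesis .
  qed
  have "(\<lambda>\<omega>. indicator A (X i \<omega>) :: real) \<in> borel_measurable M" if "i \<in> {1..n}" for i
    by (rule measurable_compose[OF X borel_measurable_indicator[OF A]]) (use that in auto)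
  then show "(\<lambda>\<omega>. emeasure (empirical_measure X n \<omega>) A) \<in> borel_measurable M"
    unfolding eq by (intro measurable_compose[OF _ measurable_ennreal] borel_measurable_divide borel_measurable_sum) auto
qed

text \<open>Pushing \<open>L x\<close> forward to the product space along the section at
  \<open>x\<close> replaces the parameter-dependent integrand by a fixed one.\<close>

lemma integral_measurable_prob_algebra:
  fixes f :: "'w \<Rightarrow> 'b \<Rightarrow> real"
  assumes f[measurable]: "(\<lambda>(x, y). f x y) \<in> borel_measurable (M \<Otimes>\<^sub>M N)"
    and L: "L \<in> measurable M (prob_algebra N)"
  shows "(\<lambda>x. \<integral>y. f x y \<partial>L x) \<in> borel_measurable M"
proof -
  note L' = measurable_prob_algebraD[OF L]
  note L'[measurable] integral_measurable_subprob_algebra[measurable] measurable_distr2[measurable]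
  have "(\<lambda>x. integral\<^sup>L (distr (L x) (M \<Otimes>\<^sub>M N) (\<lambda>y. (x, y))) (\<lambda>(x, y). f x y)) \<in> borel_measurable M"
    by measurable
  then show ?thesis
    by (rule measurable_cong[THEN iffD1, rotated])
       (simp add: integral_distr L' sets_kernel[OF L'])
qed

section \<open>Existence, uniqueness and formulas for the mean embedding\<close>

locale bounded_rkhs = rkhs H ip k
  for H :: "('a::second_countable_topology \<Rightarrow> real) set" and ip k +
  assumes H_measurable: "H \<subseteq> borel_measurable borel"
    and kernel_bounded: "bounded_kernel k"
begin

definition kbound :: real where "kbound = (SUP x. sqrt (k x x))"

abbreviation emb :: "'a measure \<Rightarrow> 'a \<Rightarrow> real" where
  "emb \<equiv> kernel_mean_embedding H ip k"

lemma sqrt_kernel_le: "sqrt (k x x) \<le> kbound"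
  unfolding kbound_def using kernel_bounded[unfolded bounded_kernel_def] by (intro cSUP_upper) auto

lemma kbound_nonneg: "0 \<le> kbound"
  using sqrt_kernel_le[of undefined] kernel_diag_nonneg[of undefined] real_sqrt_ge_zero order_trans by blast

lemma eval_bound:
  assumes "f \<in> H"
  shows "\<bar>f x\<bar> \<le> kbound * nrm f"
proof -
  have "\<bar>f x\<bar> \<le> nrm f * sqrt (k x x)"
    using Cauchy_Schwarz[OF assms kernel_mem, of x] by (simp add: reproducing assms nrm_kernel)
  also have "\<dots> \<le> nrm f * kbound"
    by (intro mult_left_mono sqrt_kernel_le nrm_nonneg assms)
  finally show ?thesis by (simp add: mult.commute)
qed

lemma H_integrable:
  assumes Q: "Q \<in> prob_measures" and f: "f \<in> H"
  shows "integrable Q f"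
proof -
  interpret prob_space Q using Q by (simp add: space_prob_algebra)
  have "f \<in> borel_measurable Q"
    using Q f H_measurable by (auto simp: space_prob_algebra cong: measurable_cong_sets)
  then show ?thesis
    using eval_bound[OF f] by (intro integrable_const_bound[of _ "kbound * nrm f"]) auto
qed

text \<open>By \<open>eval_bound\<close>, integration against \<open>Q\<close> is a bounded linear
  functional on \<open>H\<close>, so it has a Riesz representer.\<close>

lemma emb_ex:
  assumes Q: "Q \<in> prob_measures"
  shows "\<exists>h\<in>H. \<forall>f\<in>H. ip f h = (\<integral>x. f x \<partial>Q)"
proof -
  interpret prob_space Q using Q by (simp add: space_prob_algebra)
  have "\<bar>\<integral>x. f x \<partial>Q\<bar> \<le> kbound * nrm f" if f: "f \<in> H" for f
  proof -
    have "\<bar>\<integral>x. f x \<partial>Q\<bar> \<le> (\<integral>x. \<bar>f x\<bar> \<partial>Q)" by (rule integral_abs_bound)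
    also have "\<dots> \<le> (\<integral>x. kbound * nrm f \<partial>Q)"
      using H_integrable[OF Q f] eval_bound[OF f] by (intro integral_mono) auto
    finally show ?thesis by (simp add: prob_space)
  qed
  then obtain h where "h \<in> H" "\<And>f. f \<in> H \<Longrightarrow> ip f h = (\<integral>x. f x \<partial>Q)"
    using Riesz_representation[of "\<lambda>f. \<integral>x. f x \<partial>Q" kbound] by (auto simp: H_integrable[OF Q])
  then show ?thesis by blast
qed

text \<open>Two representers of the same functional differ by an element orthogonal to
  \<open>H\<close>, in particular to itself. This uniqueness gives the definite description in
  \<open>kernel_mean_embedding\<close> its value.\<close>

lemma emb_eqI:
  assumes h: "h \<in> H" and ip: "\<And>f. f \<in> H \<Longrightarrow> ip f h = (\<integral>x. f x \<partial>Q)"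
  shows "emb Q = h"
  unfolding kernel_mean_embedding_def
proof (rule the_equality)
  show "h \<in> H \<and> (\<forall>f\<in>H. ip f h = (\<integral>x. ip f (\<lambda>y. k y x) \<partial>Q))"
    using h ip by (simp add: reproducing)
  fix g assume g: "g \<in> H \<and> (\<forall>f\<in>H. ip f g = (\<integral>x. ip f (\<lambda>y. k y x) \<partial>Q))"
  then have "ip f g = ip f h" if "f \<in> H" for f using ip that by (simp add: reproducing)
  then have "ip (\<lambda>x. g x - h x) (\<lambda>x. g x - h x) = 0"
    using g h diff_mem[of g h] ip_diff_right[of g h] by simp
  then have "(\<lambda>x. g x - h x) = (\<lambda>x. 0)" using ip_eq_zero diff_mem g h by blast
  then show "g = h" by (simp add: fun_eq_iff)
qed

lemma
  assumes Q: "Q \<in> prob_measures"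
  shows emb_mem: "emb Q \<in> H" and ip_emb: "f \<in> H \<Longrightarrow> ip f (emb Q) = (\<integral>x. f x \<partial>Q)"
  using emb_ex[OF Q] emb_eqI by blast+

lemma emb_apply:
  assumes Q: "Q \<in> prob_measures"
  shows "emb Q = (\<lambda>x. \<integral>y. k y x \<partial>Q)"
proof
  fix x
  show "emb Q x = (\<integral>y. k y x \<partial>Q)"
    using reproducing[OF emb_mem[OF Q], of x] ip_commute[OF emb_mem[OF Q] kernel_mem, of x]
      ip_emb[OF Q kernel_mem, of x] by simp
qed

lemma ip_emb_emb:
  assumes Q: "Q \<in> prob_measures" and R: "R \<in> prob_measures"
  shows "ip (emb Q) (emb R) = (\<integral>x. \<integral>y. k y x \<partial>Q \<partial>R)"
  unfolding ip_emb[OF R emb_mem[OF Q]] by (simp only: emb_apply[OF Q])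

text \<open>Only integrals of \<open>k\<close> occur on the right, from which measurability of the
  discrepancy is read off later.\<close>

lemma mmd_sq:
  assumes Q: "Q \<in> prob_measures" and R: "R \<in> prob_measures"
  shows "(mmd H ip k Q R)\<^sup>2 = (\<integral>x. \<integral>y. k y x \<partial>Q \<partial>Q) - 2 * (\<integral>x. \<integral>y. k y x \<partial>Q \<partial>R) + (\<integral>x. \<integral>y. k y x \<partial>R \<partial>R)"
  unfolding mmd_def nrm_diff_sq[OF emb_mem[OF Q] emb_mem[OF R]] nrm_sq[OF emb_mem[OF Q]]
    nrm_sq[OF emb_mem[OF R]] by (simp only: ip_emb_emb Q R)

lemma mmd_nonneg: "Q \<in> prob_measures \<Longrightarrow> R \<in> prob_measures \<Longrightarrow> 0 \<le> mmd H ip k Q R"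
  by (simp add: mmd_def nrm_nonneg diff_mem emb_mem)

lemma mmd_commute:
  "Q \<in> prob_measures \<Longrightarrow> R \<in> prob_measures \<Longrightarrow> mmd H ip k Q R = mmd H ip k R Q"
  unfolding mmd_def by (rule nrm_diff_commute[OF emb_mem emb_mem])

lemma mmd_triangle:
  "Q \<in> prob_measures \<Longrightarrow> R \<in> prob_measures \<Longrightarrow> S \<in> prob_measures \<Longrightarrow>
    mmd H ip k Q S \<le> mmd H ip k Q R + mmd H ip k R S"
  unfolding mmd_def by (rule nrm_diff_triangle[OF emb_mem emb_mem emb_mem])

lemma emb_empirical_measure:
  assumes n: "n \<ge> 1"
  shows "emb (empirical_measure X n \<omega>) = (\<lambda>y. (1 / real n) * (\<Sum>i=1..n. k y (X i \<omega>)))"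
proof (rule emb_eqI)
  have S: "(\<lambda>y. \<Sum>i=1..n. k y (X i \<omega>)) \<in> H" using kernel_comb_mem[of "\<lambda>_. 1"] by simp
  then show "(\<lambda>y. (1 / real n) * (\<Sum>i=1..n. k y (X i \<omega>))) \<in> H" by (rule scale_mem)
  fix f assume f: "f \<in> H"
  have "ip f (\<lambda>y. \<Sum>i=1..n. k y (X i \<omega>)) = (\<Sum>i=1..n. f (X i \<omega>))"
    using ip_kernel_comb[OF f, of "\<lambda>_. 1"] by simp
  then show "ip f (\<lambda>y. (1 / real n) * (\<Sum>i=1..n. k y (X i \<omega>))) = (\<integral>x. f x \<partial>empirical_measure X n \<omega>)"
    using integral_empirical_measure[OF n, of f X \<omega>] f H_measurable
    by (simp only: ip_scale_right[OF S f]) auto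
qed

lemma embedding_error_eq_mmd:
  "n \<ge> 1 \<Longrightarrow> embedding_error H ip k X P n \<omega> = mmd H ip k (empirical_measure X n \<omega>) (P \<omega>)"
  by (simp add: embedding_error_def mmd_def emb_empirical_measure)

end

section \<open>Finite-dimensional approximation of mean embeddings\<close>

context bounded_rkhs
begin

section \<open>The distance between kernel functions\<close>

abbreviation kdist :: "'a \<Rightarrow> 'a \<Rightarrow> real" where
  "kdist x y \<equiv> nrm (\<lambda>z. k z x - k z y)"

text \<open>Through this formula continuity of \<open>k\<close> carries over to
  \<open>kdist\<close>.\<close>

lemma kdist_eq: "kdist x y = sqrt (k x x - 2 * k x y + k y y)"
proof -
  have "(kdist x y)\<^sup>2 = k x x - 2 * k x y + k y y"
    unfolding nrm_diff_sq[OF kernel_mem kernel_mem] nrm_kernel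
    by (simp add: reproducing kernel_mem kernel_diag_nonneg kernel_commute[of y x])
  then show ?thesis
    using nrm_nonneg[OF diff_mem[OF kernel_mem kernel_mem], of x y] by (metis real_sqrt_abs abs_of_nonneg)
qed

lemma kdist_nonneg: "0 \<le> kdist x y"
  by (intro nrm_nonneg diff_mem kernel_mem)

lemma continuous_on_kdist:
  assumes "continuous_kernel k"
  shows "continuous_on UNIV (kdist x)"
proof -
  have k: "continuous_on UNIV (\<lambda>(x, y). k x y)"
    using assms by (simp add: continuous_kernel_def)
  have "continuous_on UNIV (\<lambda>y. (x, y))" "continuous_on UNIV (\<lambda>y::'a. (y, y))"
    by (intro continuous_intros)+
  then have "continuous_on UNIV (\<lambda>y. k x y)" "continuous_on UNIV (\<lambda>y. k y y)"
    using continuous_on_compose2[OF k, of UNIV "\<lambda>y. (x, y)"] continuous_on_compose2[OF k, of UNIV "\<lambda>y. (y, y)"]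
    by auto
  then show ?thesis unfolding kdist_eq by (intro continuous_intros)
qed

text \<open>Cauchy-Schwarz against a difference of kernel functions; it makes the unit ball of
  \<open>H\<close> uniformly Lipschitz for \<open>kdist\<close>.\<close>

lemma eval_diff_bound:
  assumes f: "f \<in> H"
  shows "\<bar>f x - f y\<bar> \<le> nrm f * kdist x y"
  using Cauchy_Schwarz[OF f diff_mem[OF kernel_mem kernel_mem], of x y]
  by (simp add: ip_diff_right f kernel_mem reproducing)

lemma nrm_kernel_comb_le: "nrm (\<lambda>y. \<Sum>i\<in>A. c i * k y (z i)) \<le> kbound * (\<Sum>i\<in>A. \<bar>c i\<bar>)"
proof (induction A rule: infinite_finite_induct)
  case (insert i A)
  have "nrm (\<lambda>y. c i * k y (z i) + (\<Sum>i\<in>A. c i * k y (z i)))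
      \<le> nrm (\<lambda>y. c i * k y (z i)) + nrm (\<lambda>y. \<Sum>i\<in>A. c i * k y (z i))"
    by (intro nrm_triangle scale_mem kernel_mem kernel_comb_mem)
  also have "\<dots> \<le> \<bar>c i\<bar> * kbound + kbound * (\<Sum>i\<in>A. \<bar>c i\<bar>)"
    unfolding nrm_scale[OF kernel_mem] nrm_kernel
    by (intro add_mono insert.IH mult_left_mono sqrt_kernel_le) simp
  finally show ?case using insert.hyps by (simp add: algebra_simps)
qed (simp_all add: nrm_zero)

section \<open>A truncated partition of unity from kernel balls\<close>

definition bump :: "real \<Rightarrow> 'a \<Rightarrow> 'a \<Rightarrow> real" where
  "bump e x y = max 0 (e - kdist x y)"

definition tot :: "(nat \<Rightarrow> 'a) \<Rightarrow> real \<Rightarrow> nat \<Rightarrow> 'a \<Rightarrow> real" where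
  "tot z e m y = (\<Sum>i<m. bump e (z i) y)"

text \<open>A partition of unity up to the mass missing where \<open>tot z e m y\<close> is below \<open>1 / Suc m\<close>; the
  missing mass tends to 0 with \<open>m\<close>.\<close>

definition weight :: "(nat \<Rightarrow> 'a) \<Rightarrow> real \<Rightarrow> nat \<Rightarrow> nat \<Rightarrow> 'a \<Rightarrow> real" where
  "weight z e m i y = bump e (z i) y / max (tot z e m y) (1 / Suc m)"

definition mass :: "(nat \<Rightarrow> 'a) \<Rightarrow> real \<Rightarrow> nat \<Rightarrow> 'a \<Rightarrow> real" where
  "mass z e m y = (\<Sum>i<m. weight z e m i y)"

lemma bump_nonneg: "0 \<le> bump e x y"
  by (simp add: bump_def)

lemma max_tot_pos: "0 < max (tot z e m y) (1 / Suc m)"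
  by (simp add: less_max_iff_disj)

lemma weight_nonneg: "0 \<le> weight z e m i y"
  unfolding weight_def using max_tot_pos bump_nonneg by (intro divide_nonneg_pos)

lemma mass_eq: "mass z e m y = tot z e m y / max (tot z e m y) (1 / Suc m)"
  by (simp only: mass_def weight_def tot_def sum_divide_distrib)

lemma mass_le_1: "mass z e m y \<le> 1"
  unfolding mass_eq using max_tot_pos[of z e m y] by (simp only: divide_le_eq_1_pos max.cobounded1)

lemma mass_nonneg: "0 \<le> mass z e m y"
  by (simp add: mass_def sum_nonneg weight_nonneg)

lemma weight_le_1: "i < m \<Longrightarrow> weight z e m i y \<le> 1"
  using member_le_sum[of i "{..<m}" "\<lambda>i. weight z e m i y"] mass_le_1[of z e m y]
  by (simp add: mass_def weight_nonneg)

text \<open>The weight vanishes at every point whose kernel distance to \<open>z i\<close> is at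
  least \<open>e\<close>.\<close>

lemma weight_kdist: "weight z e m i y * kdist y (z i) \<le> weight z e m i y * e"
proof (cases "kdist (z i) y < e")
  case True
  then have "kdist y (z i) \<le> e" using nrm_diff_commute[OF kernel_mem kernel_mem, of y "z i"] by simp
  then show ?thesis by (intro mult_left_mono weight_nonneg)
next
  case False
  then show ?thesis by (simp add: weight_def bump_def)
qed

lemma continuous_on_weight:
  assumes "continuous_kernel k"
  shows "continuous_on UNIV (weight z e m i)"
proof -
  have b: "continuous_on UNIV (bump e x)" for x
    unfolding bump_def by (intro continuous_intros continuous_on_kdist[OF assms])
  then have "continuous_on UNIV (tot z e m)"
    unfolding tot_def by (intro continuous_intros)
  \<comment> \<open>The floor \<open>1 / Suc m\<close> keeps the denominator positive even where all
    bumps vanish.\<close>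
  moreover have "max (tot z e m y) (1 / Suc m) \<noteq> 0" for y
    using max_tot_pos[of z e m y] by (rule less_imp_neq[symmetric])
  ultimately show ?thesis
    unfolding weight_def by (intro continuous_on_divide continuous_on_max continuous_on_const b ballI)
qed

lemma continuous_on_mass: "continuous_kernel k \<Longrightarrow> continuous_on UNIV (mass z e m)"
  unfolding mass_def by (intro continuous_on_sum continuous_on_weight)

lemma weight_integrable:
  assumes "continuous_kernel k" and Q: "Q \<in> prob_measures" and i: "i < m"
  shows "integrable Q (weight z e m i)"
proof -
  interpret prob_space Q using Q by (simp add: space_prob_algebra)
  have "weight z e m i \<in> borel_measurable borel"
    by (intro borel_measurable_continuous_onI continuous_on_weight assms)
  then have "weight z e m i \<in> borel_measurable Q"
    using Q by (simp add: space_prob_algebra cong: measurable_cong_sets)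
  then show ?thesis
    using weight_nonneg weight_le_1[OF i] by (intro integrable_const_bound[of _ 1]) auto
qed

lemma mass_integrable:
  "continuous_kernel k \<Longrightarrow> Q \<in> prob_measures \<Longrightarrow> integrable Q (mass z e m)"
  unfolding mass_def by (intro Bochner_Integration.integrable_sum weight_integrable) auto

text \<open>Some centre \<open>z i\<close> is closer than \<open>e\<close> to \<open>y\<close>; as
  soon as \<open>i < m\<close> and the floor \<open>1 / Suc m\<close> is below its bump at
  \<open>y\<close>, the mass is exactly 1.\<close>

lemma mass_tendsto_1:
  assumes cont: "continuous_kernel k" and dense: "\<And>U. open U \<Longrightarrow> U \<noteq> {} \<Longrightarrow> \<exists>i. z i \<in> U" and e: "e > 0"
  shows "(\<lambda>m. mass z e m y) \<longlonglongrightarrow> 1"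
proof -
  have "kdist y y < e" using e by (simp add: nrm_zero)
  moreover have "open {x. kdist y x < e}"
    by (intro open_Collect_less continuous_on_kdist cont continuous_on_const)
  ultimately obtain i where "kdist y (z i) < e" using dense by blast
  then have i: "0 < bump e (z i) y"
    using nrm_diff_commute[OF kernel_mem kernel_mem, of y "z i"] by (simp add: bump_def)
  then obtain N where N: "1 / Suc N < bump e (z i) y"
    using reals_Archimedean by (auto simp: inverse_eq_divide)
  have "mass z e m y = 1" if m: "m \<ge> max N (Suc i)" for m
  proof -
    have "1 / real (Suc m) \<le> 1 / real (Suc N)" using m by (simp add: frac_le)
    also note N
    also have "bump e (z i) y \<le> tot z e m y"
      unfolding tot_def using m by (intro member_le_sum) (auto simp: bump_nonneg)
    finally have *: "1 / real (Suc m) < tot z e m y" .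
    moreover have "0 < 1 / real (Suc m)" by simp
    ultimately have "tot z e m y > 0" by linarith
    then show ?thesis unfolding mass_eq using * by (simp add: max_absorb1)
  qed
  then show ?thesis
    by (intro tendsto_eventually eventually_sequentiallyI)
qed

lemma integral_mass_tendsto_1:
  assumes cont: "continuous_kernel k" and dense: "\<And>U. open U \<Longrightarrow> U \<noteq> {} \<Longrightarrow> \<exists>i. z i \<in> U" and e: "e > 0"
    and Q: "Q \<in> prob_measures"
  shows "(\<lambda>m. \<integral>y. mass z e m y \<partial>Q) \<longlonglongrightarrow> 1"
proof -
  interpret prob_space Q using Q by (simp add: space_prob_algebra)
  have "(\<lambda>m. \<integral>y. mass z e m y \<partial>Q) \<longlonglongrightarrow> (\<integral>y. 1 \<partial>Q)"
  proof (rule integral_dominated_convergence[where w = "\<lambda>_. 1"])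
    show "mass z e m \<in> borel_measurable Q" for m
      using mass_integrable[OF cont Q] by (rule borel_measurable_integrable)
    show "AE y in Q. (\<lambda>m. mass z e m y) \<longlonglongrightarrow> 1"
      using mass_tendsto_1[OF cont dense e] by simp
    show "AE y in Q. norm (mass z e m y) \<le> 1" for m
      using mass_le_1 mass_nonneg by simp
  qed auto
  then show ?thesis by (simp add: prob_space)
qed

section \<open>Approximation of embeddings by finite kernel combinations\<close>

abbreviation approx :: "(nat \<Rightarrow> 'a) \<Rightarrow> real \<Rightarrow> nat \<Rightarrow> 'a measure \<Rightarrow> 'a \<Rightarrow> real" where
  "approx z e m R \<equiv> (\<lambda>y. \<Sum>i<m. (\<integral>x. weight z e m i x \<partial>R) * k y (z i))"

text \<open>The squared norm of the error \<open>h\<close> is the integral of \<open>h\<close> minus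
  its weighted values at the centres. Where weights act, \<open>h\<close> varies by at most
  \<open>nrm h * e\<close>; missing mass costs at most \<open>kbound * nrm h\<close> per unit; then
  one factor \<open>nrm h\<close> cancels.\<close>

lemma emb_approx:
  assumes cont: "continuous_kernel k" and e: "e \<ge> 0" and R: "R \<in> prob_measures"
  shows "nrm (\<lambda>y. emb R y - approx z e m R y) \<le> e + kbound * (1 - (\<integral>x. mass z e m x \<partial>R))"
proof -
  interpret prob_space R using R by (simp add: space_prob_algebra)
  define h where "h = (\<lambda>y. emb R y - approx z e m R y)"
  define b where "b = e + kbound * (1 - (\<integral>x. mass z e m x \<partial>R))"
  have h: "h \<in> H" unfolding h_def by (intro diff_mem emb_mem R kernel_comb_mem)
  have pt: "h y - (\<Sum>i<m. weight z e m i y * h (z i)) \<le> nrm h * (e + kbound * (1 - mass z e m y))" for y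
  proof -
    have "h y - (\<Sum>i<m. weight z e m i y * h (z i))
        = (1 - mass z e m y) * h y + (\<Sum>i<m. weight z e m i y * (h y - h (z i)))"
      by (simp add: mass_def algebra_simps sum_subtractf sum_distrib_right sum_distrib_left)
    also have "\<dots> \<le> (1 - mass z e m y) * (kbound * nrm h) + (\<Sum>i<m. weight z e m i y * (nrm h * kdist y (z i)))"
      using eval_bound[OF h, of y] eval_diff_bound[OF h, of y] mass_le_1[of z e m y]
      by (intro add_mono mult_left_mono sum_mono weight_nonneg) (auto simp: abs_le_iff)
    also have "(\<Sum>i<m. weight z e m i y * (nrm h * kdist y (z i))) = nrm h * (\<Sum>i<m. weight z e m i y * kdist y (z i))"
      by (simp add: sum_distrib_left mult_ac)
    also have "\<dots> \<le> nrm h * (\<Sum>i<m. weight z e m i y * e)"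
      by (intro mult_left_mono sum_mono weight_kdist nrm_nonneg h)
    also have "(\<Sum>i<m. weight z e m i y * e) = mass z e m y * e"
      by (simp add: mass_def sum_distrib_right)
    also have "nrm h * (mass z e m y * e) \<le> nrm h * (1 * e)"
      by (intro mult_left_mono mult_right_mono mass_le_1 e nrm_nonneg h)
    finally show ?thesis by (simp add: algebra_simps)
  qed
  have w: "integrable R (\<lambda>y. weight z e m i y * h (z i))" if "i < m" for i
    using weight_integrable[OF cont R that] by simp
  have W: "integrable R (\<lambda>y. \<Sum>i<m. weight z e m i y * h (z i))"
    by (intro Bochner_Integration.integrable_sum w) auto
  have W': "(\<integral>y. (\<Sum>i<m. weight z e m i y * h (z i)) \<partial>R) = (\<Sum>i<m. (\<integral>x. weight z e m i x \<partial>R) * h (z i))"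
    by (subst Bochner_Integration.integral_sum) (auto intro: weight_integrable[OF cont R])
  have "(nrm h)\<^sup>2 = ip h (emb R) - ip h (approx z e m R)"
    unfolding nrm_sq[OF h] by (subst (2) h_def) (intro ip_diff_right emb_mem R kernel_comb_mem h)
  also have "\<dots> = (\<integral>y. h y \<partial>R) - (\<Sum>i<m. (\<integral>x. weight z e m i x \<partial>R) * h (z i))"
    by (simp only: ip_emb[OF R h] ip_kernel_comb[OF h])
  also have "\<dots> = (\<integral>y. h y - (\<Sum>i<m. weight z e m i y * h (z i)) \<partial>R)"
    by (simp only: Bochner_Integration.integral_diff[OF H_integrable[OF R h] W] W')
  also have "\<dots> \<le> (\<integral>y. nrm h * (e + kbound * (1 - mass z e m y)) \<partial>R)"
    using pt w H_integrable[OF R h] mass_integrable[OF cont R]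
    by (intro integral_mono Bochner_Integration.integrable_diff Bochner_Integration.integrable_sum integrable_mult_right
        Bochner_Integration.integrable_add) auto
  also have "\<dots> = nrm h * b"
    using mass_integrable[OF cont R] by (simp add: b_def prob_space)
  finally have "nrm h * nrm h \<le> nrm h * b" by (simp add: power2_eq_square)
  moreover have "(\<integral>x. mass z e m x \<partial>R) \<le> (\<integral>x. 1 \<partial>R)"
    using mass_integrable[OF cont R] mass_le_1 by (intro integral_mono) auto
  then have "0 \<le> b"
    unfolding b_def using e kbound_nonneg by (simp add: prob_space)
  \<comment> \<open>When \<open>nrm h\<close> is 0 it cannot be cancelled, and the bound comes from
    \<open>0 \<le> b\<close>.\<close>
  ultimately have "nrm h \<le> b"
    using nrm_nonneg[OF h] by (cases "nrm h = 0") auto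
  then show ?thesis by (simp add: h_def b_def)
qed

end

section \<open>Weak convergence, separability and measurability of the discrepancy\<close>

lemma dense_sequence:
  obtains z :: "nat \<Rightarrow> 'a::second_countable_topology" where "\<And>U. open U \<Longrightarrow> U \<noteq> {} \<Longrightarrow> \<exists>i. z i \<in> U"
proof -
  obtain D :: "'a set" where D: "countable D" "\<And>U. open U \<Longrightarrow> U \<noteq> {} \<Longrightarrow> \<exists>d\<in>D. d \<in> U"
    using countable_dense_setE by blast
  have "D \<noteq> {}" using D(2)[of UNIV] by auto
  then have "range (from_nat_into D) = D" using D(1) by simp
  then show ?thesis using D(2) that[of "from_nat_into D"] by (metis rangeE)
qed

context bounded_rkhs
begin

lemma ex_approx_index:
  assumes cont: "continuous_kernel k" and dense: "\<And>U. open U \<Longrightarrow> U \<noteq> {} \<Longrightarrow> \<exists>i. z i \<in> U" and e: "e > 0"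
    and Q: "Q \<in> prob_measures"
  shows "\<exists>m. e + kbound * (1 - (\<integral>x. mass z e m x \<partial>Q)) < 2 * e"
proof -
  have "(\<lambda>m. e + kbound * (1 - (\<integral>x. mass z e m x \<partial>Q))) \<longlonglongrightarrow> e + kbound * (1 - 1)"
    by (intro tendsto_intros integral_mass_tendsto_1[OF cont dense e Q])
  then have "\<forall>\<^sub>F m in sequentially. e + kbound * (1 - (\<integral>x. mass z e m x \<partial>Q)) < 2 * e"
    by (rule order_tendstoD(2)) (use e in simp)
  then show ?thesis by (auto simp only: eventually_sequentially)
qed

text \<open>The index \<open>m\<close> is chosen for the limit \<open>Q\<close> only. The
  approximation errors and the distance of the two approximants are bounded through finitely many
  integrals of bounded continuous functions, all of which converge.\<close>

lemma mmd_tendsto_zero: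
  assumes cont: "continuous_kernel k" and Q: "Q \<in> prob_measures"
    and s: "\<forall>\<^sub>F n in F. s n \<in> prob_measures"
    and lim: "\<And>f :: 'a \<Rightarrow> real. continuous_on UNIV f \<Longrightarrow> bounded (range f) \<Longrightarrow>
      ((\<lambda>n. \<integral>x. f x \<partial>s n) \<longlongrightarrow> (\<integral>x. f x \<partial>Q)) F"
  shows "((\<lambda>n. mmd H ip k (s n) Q) \<longlongrightarrow> 0) F"
proof (rule tendstoI)
  fix r :: real assume "r > 0"
  \<comment> \<open>The limit of the bound \<open>B\<close> consists of two terms below
    \<open>2 * e\<close> each, hence is below \<open>4 * e = r\<close>.\<close>
  define e where "e = r / 4"
  have e: "e > 0" using \<open>r > 0\<close> by (simp add: e_def)
  obtain z :: "nat \<Rightarrow> 'a" where z: "\<And>U. open U \<Longrightarrow> U \<noteq> {} \<Longrightarrow> \<exists>i. z i \<in> U" using dense_sequence by blast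
  obtain m where m: "e + kbound * (1 - (\<integral>x. mass z e m x \<partial>Q)) < 2 * e"
    using ex_approx_index[OF cont z e Q] by blast
  define B where "B n = (e + kbound * (1 - (\<integral>x. mass z e m x \<partial>s n)))
    + kbound * (\<Sum>i<m. \<bar>(\<integral>x. weight z e m i x \<partial>s n) - (\<integral>x. weight z e m i x \<partial>Q)\<bar>)
    + (e + kbound * (1 - (\<integral>x. mass z e m x \<partial>Q)))" for n
  have le: "mmd H ip k (s n) Q \<le> B n" if sn: "s n \<in> prob_measures" for n
  proof -
    let ?a = "approx z e m"
    have "nrm (\<lambda>y. ?a (s n) y - ?a Q y) \<le> kbound * (\<Sum>i<m. \<bar>(\<integral>x. weight z e m i x \<partial>s n) - (\<integral>x. weight z e m i x \<partial>Q)\<bar>)"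
      using nrm_kernel_comb_le[of "\<lambda>i. (\<integral>x. weight z e m i x \<partial>s n) - (\<integral>x. weight z e m i x \<partial>Q)" z "{..<m}"]
      by (simp add: left_diff_distrib sum_subtractf)
    moreover have "nrm (\<lambda>y. emb (s n) y - ?a (s n) y) \<le> e + kbound * (1 - (\<integral>x. mass z e m x \<partial>s n))"
      using e by (intro emb_approx cont sn) simp
    moreover have "nrm (\<lambda>y. ?a Q y - emb Q y) \<le> e + kbound * (1 - (\<integral>x. mass z e m x \<partial>Q))"
      using e by (subst nrm_diff_commute[OF kernel_comb_mem emb_mem[OF Q]]) (intro emb_approx cont Q, simp)
    moreover have "mmd H ip k (s n) Q \<le> nrm (\<lambda>y. emb (s n) y - ?a (s n) y) + nrm (\<lambda>y. ?a (s n) y - emb Q y)"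
      unfolding mmd_def by (intro nrm_diff_triangle emb_mem sn Q kernel_comb_mem)
    moreover have "nrm (\<lambda>y. ?a (s n) y - emb Q y) \<le> nrm (\<lambda>y. ?a (s n) y - ?a Q y) + nrm (\<lambda>y. ?a Q y - emb Q y)"
      by (intro nrm_diff_triangle emb_mem Q kernel_comb_mem)
    ultimately show ?thesis unfolding B_def by linarith
  qed
  have "((\<lambda>n. \<integral>x. mass z e m x \<partial>s n) \<longlongrightarrow> (\<integral>x. mass z e m x \<partial>Q)) F"
    using mass_le_1 mass_nonneg
    by (intro lim continuous_on_mass cont) (auto intro!: boundedI[where B = 1])
  moreover have "((\<lambda>n. \<integral>x. weight z e m i x \<partial>s n) \<longlongrightarrow> (\<integral>x. weight z e m i x \<partial>Q)) F" if "i < m" for i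
    using weight_le_1[OF that] weight_nonneg
    by (intro lim continuous_on_weight cont) (auto intro!: boundedI[where B = 1])
  ultimately have "(B \<longlongrightarrow> (e + kbound * (1 - (\<integral>x. mass z e m x \<partial>Q)))
    + kbound * (\<Sum>i<m. \<bar>(\<integral>x. weight z e m i x \<partial>Q) - (\<integral>x. weight z e m i x \<partial>Q)\<bar>)
    + (e + kbound * (1 - (\<integral>x. mass z e m x \<partial>Q)))) F"
    unfolding B_def by (intro tendsto_intros) auto
  then have "\<forall>\<^sub>F n in F. B n < r"
    by (rule order_tendstoD(2)) (use m in \<open>simp add: e_def\<close>)
  with s show "\<forall>\<^sub>F n in F. dist (mmd H ip k (s n) Q) 0 < r"
    by eventually_elim (use le mmd_nonneg[OF _ Q] in force)
qed

text \<open>Rational combinations of kernel functions at a dense sequence are countable and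
  approximate every embedding, but need not be embeddings. One measure is therefore picked from each
  nonempty small ball around such a combination.\<close>

lemma mmd_separable:
  assumes cont: "continuous_kernel k"
  obtains S where "countable S" "S \<subseteq> prob_measures"
    "\<And>Q e. Q \<in> prob_measures \<Longrightarrow> e > 0 \<Longrightarrow> \<exists>R\<in>S. mmd H ip k Q R < e"
proof -
  obtain z :: "nat \<Rightarrow> 'a" where z: "\<And>U. open U \<Longrightarrow> U \<noteq> {} \<Longrightarrow> \<exists>i. z i \<in> U" using dense_sequence by blast
  define comb where "comb l = (\<lambda>y. \<Sum>i<length l. of_rat (l ! i) * k y (z i))" for l :: "rat list"
  have comb_mem: "comb l \<in> H" for l unfolding comb_def by (rule kernel_comb_mem)
  have near: "\<exists>l. nrm (\<lambda>y. emb Q y - comb l y) < e" if Q: "Q \<in> prob_measures" and "e > 0" for Q e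
  proof -
    \<comment> \<open>Two thirds of \<open>e\<close> go to the partition of unity, one third to
      rounding the coefficients.\<close>
    define e' where "e' = e / 3"
    have e': "e' > 0" using \<open>e > 0\<close> by (simp add: e'_def)
    obtain m where m: "e' + kbound * (1 - (\<integral>x. mass z e' m x \<partial>Q)) < 2 * e'"
      using ex_approx_index[OF cont z e' Q] by blast
    define c where "c i = (\<integral>x. weight z e' m i x \<partial>Q)" for i
    \<comment> \<open>Rounding \<open>m\<close> coefficients by less than \<open>t\<close> moves the
      norm by at most \<open>kbound * m * t\<close>, hence by at most \<open>e'\<close>;
      \<open>kbound + 1\<close> and \<open>Suc m\<close> keep the denominator positive.\<close>
    define t where "t = e' / ((kbound + 1) * real (Suc m))"
    have t: "t > 0" using e' kbound_nonneg by (simp add: t_def)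
    have "\<exists>q::rat. \<bar>c i - of_rat q\<bar> < t" for i
      using of_rat_dense[of "c i - t" "c i + t"] t by (auto simp: abs_less_iff) (smt (verit))
    then obtain q where q: "\<And>i. \<bar>c i - of_rat (q i)\<bar> < t" by metis
    define l where "l = map q [0..<m]"
    have cl: "comb l = (\<lambda>y. \<Sum>i<m. of_rat (q i) * k y (z i))"
      by (simp add: comb_def l_def)
    have "nrm (\<lambda>y. approx z e' m Q y - comb l y) \<le> kbound * (\<Sum>i<m. \<bar>c i - of_rat (q i)\<bar>)"
      using nrm_kernel_comb_le[of "\<lambda>i. c i - of_rat (q i)" z "{..<m}"]
      by (simp add: cl c_def left_diff_distrib sum_subtractf)
    also have "\<dots> \<le> (kbound + 1) * (\<Sum>i<m. t)"
      using kbound_nonneg by (intro mult_mono sum_mono sum_nonneg less_imp_le[OF q]) auto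
    also have "\<dots> \<le> (kbound + 1) * (real (Suc m) * t)"
      using t kbound_nonneg by (intro mult_left_mono) auto
    also have "\<dots> = e'" using kbound_nonneg by (simp add: t_def)
    finally have "nrm (\<lambda>y. approx z e' m Q y - comb l y) \<le> e'" .
    moreover have "nrm (\<lambda>y. emb Q y - approx z e' m Q y) < 2 * e'"
      using emb_approx[OF cont _ Q, of e' z m] e' m by linarith
    moreover have "nrm (\<lambda>y. emb Q y - comb l y) \<le> nrm (\<lambda>y. emb Q y - approx z e' m Q y) + nrm (\<lambda>y. approx z e' m Q y - comb l y)"
      by (intro nrm_diff_triangle emb_mem Q kernel_comb_mem comb_mem)
    ultimately show ?thesis by (intro exI[of _ l]) (simp add: e'_def)
  qed
  define A where "A = (\<lambda>(l, n). {R \<in> prob_measures. nrm (\<lambda>y. emb R y - comb l y) < 1 / Suc n})"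
  define S where "S = (\<lambda>p. SOME R. R \<in> A p) ` {p. A p \<noteq> {}}"
  show ?thesis
  proof (rule that)
    show "countable S" unfolding S_def by (intro countable_image countableI_type)
    have A: "(SOME R. R \<in> A p) \<in> A p" if "A p \<noteq> {}" for p using that some_in_eq by blast
    then show "S \<subseteq> prob_measures" unfolding S_def by (fastforce simp: A_def)
    fix Q :: "'a measure" and e :: real assume Q: "Q \<in> prob_measures" and "e > 0"
    \<comment> \<open>The way from \<open>Q\<close> to \<open>R\<close> leads over the centre
      \<open>comb l\<close> and costs the radius twice, hence \<open>e / 2\<close>.\<close>
    then obtain n where n: "1 / Suc n < e / 2"
      using reals_Archimedean[of "e / 2"] by (auto simp: inverse_eq_divide)
    obtain l where l: "nrm (\<lambda>y. emb Q y - comb l y) < 1 / Suc n"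
      using near[OF Q, of "1 / Suc n"] by auto
    then have "Q \<in> A (l, n)" using Q by (simp add: A_def)
    define R where "R = (SOME R. R \<in> A (l, n))"
    have RA: "R \<in> A (l, n)" unfolding R_def using \<open>Q \<in> A (l, n)\<close> by (rule someI)
    have "R \<in> S" unfolding S_def R_def using \<open>Q \<in> A (l, n)\<close> by blast
    moreover have "mmd H ip k Q R < e"
    proof -
      have R: "R \<in> prob_measures" "nrm (\<lambda>y. emb R y - comb l y) < 1 / Suc n"
        using RA by (auto simp: A_def)
      have "mmd H ip k Q R \<le> nrm (\<lambda>y. emb Q y - comb l y) + nrm (\<lambda>y. comb l y - emb R y)"
        unfolding mmd_def by (intro nrm_diff_triangle emb_mem Q R comb_mem)
      also have "nrm (\<lambda>y. comb l y - emb R y) = nrm (\<lambda>y. emb R y - comb l y)"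
        by (intro nrm_diff_commute emb_mem R comb_mem)
      finally show ?thesis using n l R(2) by argo
    qed
    ultimately show "\<exists>R\<in>S. mmd H ip k Q R < e" by blast
  qed
qed

lemma mmd_measurable:
  assumes cont: "continuous_kernel k"
    and Q: "Q \<in> measurable N (prob_algebra borel)" and R: "R \<in> measurable N (prob_algebra borel)"
  shows "(\<lambda>\<omega>. mmd H ip k (Q \<omega>) (R \<omega>)) \<in> borel_measurable N"
proof -
  \<comment> \<open>Continuity gives measurability for the Borel sets of the product, which by
    second countability form the product sigma-algebra.\<close>
  have k: "(\<lambda>(x, y). k x y) \<in> borel_measurable (borel \<Otimes>\<^sub>M borel)"
    unfolding borel_prod using cont by (intro borel_measurable_continuous_onI) (simp add: continuous_kernel_def)
  \<comment> \<open>The free variable \<open>x\<close> of the inner integral joins the parameter, so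
    that the outer integral is again one of a jointly measurable function against a random
    measure.\<close>
  have inner: "(\<lambda>(\<omega>, x). \<integral>y. k y x \<partial>Q \<omega>) \<in> borel_measurable (N \<Otimes>\<^sub>M borel)"
    if Q: "Q \<in> measurable N (prob_algebra borel)" for Q
  proof -
    have "(\<lambda>p. \<integral>y. k y (snd p) \<partial>Q (fst p)) \<in> borel_measurable (N \<Otimes>\<^sub>M borel)"
    proof (rule integral_measurable_prob_algebra)
      have "(\<lambda>p. (snd p, snd (fst p))) \<in> measurable ((N \<Otimes>\<^sub>M borel) \<Otimes>\<^sub>M borel) (borel \<Otimes>\<^sub>M borel)"
        by measurable
      from measurable_compose[OF this k]
      show "(\<lambda>(p, y). k y (snd p)) \<in> borel_measurable ((N \<Otimes>\<^sub>M borel) \<Otimes>\<^sub>M borel)"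
        by (simp add: case_prod_beta')
      show "(\<lambda>p. Q (fst p)) \<in> measurable (N \<Otimes>\<^sub>M borel) (prob_algebra borel)"
        by (rule measurable_compose[OF measurable_fst Q])
    qed
    then show ?thesis by (simp add: case_prod_beta')
  qed
  have I: "(\<lambda>\<omega>. \<integral>x. \<integral>y. k y x \<partial>Q \<omega> \<partial>R \<omega>) \<in> borel_measurable N"
    if "Q \<in> measurable N (prob_algebra borel)" "R \<in> measurable N (prob_algebra borel)" for Q R
    by (rule integral_measurable_prob_algebra[OF inner[OF that(1)] that(2)])
  have "(\<lambda>\<omega>. sqrt ((\<integral>x. \<integral>y. k y x \<partial>Q \<omega> \<partial>Q \<omega>) - 2 * (\<integral>x. \<integral>y. k y x \<partial>Q \<omega> \<partial>R \<omega>)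
      + (\<integral>x. \<integral>y. k y x \<partial>R \<omega> \<partial>R \<omega>))) \<in> borel_measurable N"
    by (intro measurable_compose[OF _ borel_measurable_sqrt] borel_measurable_add borel_measurable_diff
        borel_measurable_times borel_measurable_const I Q R)
  also have "?this \<longleftrightarrow> ?thesis"
  proof (rule measurable_cong)
    fix \<omega> assume "\<omega> \<in> space N"
    then have "Q \<omega> \<in> prob_measures" "R \<omega> \<in> prob_measures"
      using measurable_space[OF Q] measurable_space[OF R] by auto
    then show "sqrt ((\<integral>x. \<integral>y. k y x \<partial>Q \<omega> \<partial>Q \<omega>) - 2 * (\<integral>x. \<integral>y. k y x \<partial>Q \<omega> \<partial>R \<omega>)
      + (\<integral>x. \<integral>y. k y x \<partial>R \<omega> \<partial>R \<omega>)) = mmd H ip k (Q \<omega>) (R \<omega>)"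
      by (simp add: mmd_sq[symmetric] mmd_nonneg)
  qed
  finally show ?thesis .
qed

end

section \<open>Metrics for weak convergence and convergence in probability\<close>

lemma topspace_weak_topology: "topspace weak_topology = (prob_measures :: 'a::topological_space measure set)"
proof -
  let ?S = "{{Q \<in> prob_measures. (\<integral>x. f x \<partial>Q) \<in> U} | (f :: 'a \<Rightarrow> real) U.
      continuous_on UNIV f \<and> bounded (range f) \<and> open U}"
  have "\<Union>?S \<subseteq> prob_measures" by blast
  \<comment> \<open>A constant function with the full line as open set yields the whole carrier as a
    subbasic set.\<close>
  moreover have "prob_measures \<in> ?S"
    by (intro CollectI exI[of _ "\<lambda>_. 0"] exI[of _ UNIV]) auto
  ultimately have "\<Union>?S = prob_measures" by blast
  then show ?thesis unfolding weak_topology_def topology_generated_by_topspace .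
qed

text \<open>One direction tests on subbasic sets; in the other, eventual membership survives finite
  intersections and unions, so induction over generated open sets applies. The filter is arbitrary
  because Dirac measures are later moved along \<open>nhds x\<close>.\<close>

lemma limitin_weak_topology:
  fixes Q :: "'a::topological_space measure"
  shows "limitin weak_topology s Q F \<longleftrightarrow>
    Q \<in> prob_measures \<and> (\<forall>\<^sub>F n in F. s n \<in> prob_measures) \<and>
    (\<forall>f :: 'a \<Rightarrow> real. continuous_on UNIV f \<longrightarrow> bounded (range f) \<longrightarrow>
      ((\<lambda>n. \<integral>x. f x \<partial>s n) \<longlongrightarrow> (\<integral>x. f x \<partial>Q)) F)" (is "?L \<longleftrightarrow> ?R")
proof
  assume L: ?L
  have Q: "Q \<in> prob_measures" using limitin_topspace[OF L] by (simp add: topspace_weak_topology)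
  have "\<forall>\<^sub>F n in F. s n \<in> topspace weak_topology"
    using L openin_topspace[of weak_topology] unfolding limitin_def by blast
  then have "\<forall>\<^sub>F n in F. s n \<in> prob_measures" by (simp add: topspace_weak_topology)
  moreover have "((\<lambda>n. \<integral>x. f x \<partial>s n) \<longlongrightarrow> (\<integral>x. f x \<partial>Q)) F"
    if f: "continuous_on UNIV f" "bounded (range f)" for f :: "'a \<Rightarrow> real"
  proof (rule topological_tendstoI)
    fix U :: "real set" assume U: "open U" "(\<integral>x. f x \<partial>Q) \<in> U"
    have "openin weak_topology {Q \<in> prob_measures. (\<integral>x. f x \<partial>Q) \<in> U}"
      unfolding weak_topology_def using f U by (intro topology_generated_by_Basis) blast
    then have "\<forall>\<^sub>F n in F. s n \<in> {Q \<in> prob_measures. (\<integral>x. f x \<partial>Q) \<in> U}"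
      using L U Q unfolding limitin_def by blast
    then show "\<forall>\<^sub>F n in F. (\<integral>x. f x \<partial>s n) \<in> U" by eventually_elim simp
  qed
  ultimately show ?R using Q by blast
next
  assume R: ?R
  have "\<forall>\<^sub>F n in F. s n \<in> U" if "openin weak_topology U" "Q \<in> U" for U
    using that(1)[unfolded weak_topology_def openin_topology_generated_by_iff] that(2)
  proof (induction rule: generate_topology_on.induct)
    case (Int a b)
    then show ?case by (auto simp: eventually_conj_iff)
  next
    case (UN K)
    then obtain A where "A \<in> K" "Q \<in> A" "\<forall>\<^sub>F n in F. s n \<in> A" by blast
    then show ?case by (auto elim: eventually_mono)
  next
    case (Basis A)
    then obtain f :: "'a \<Rightarrow> real" and U where A: "A = {Q \<in> prob_measures. (\<integral>x. f x \<partial>Q) \<in> U}"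
      and f: "continuous_on UNIV f" "bounded (range f)" "open U" by blast
    have "\<forall>\<^sub>F n in F. (\<integral>x. f x \<partial>s n) \<in> U"
      using R f Basis.prems A topological_tendstoD by blast
    moreover have "\<forall>\<^sub>F n in F. s n \<in> prob_measures" using R by blast
    ultimately show ?case by eventually_elim (simp add: A)
  qed simp
  then show ?L using R unfolding limitin_def by (simp add: topspace_weak_topology)
qed

text \<open>The points eventually lie in the carrier, so the cut-off in \<open>on_carrier\<close>
  does not affect limits.\<close>

lemma metrizes_limitin:
  assumes d: "metrizes_weak_convergence d" and s: "\<forall>\<^sub>F n in F. s n \<in> prob_measures" and Q: "Q \<in> prob_measures"
  shows "limitin weak_topology s Q F \<longleftrightarrow> ((\<lambda>n. d (s n) Q) \<longlongrightarrow> 0) F"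
proof -
  interpret Metric_space prob_measures "on_carrier prob_measures d"
    using d by (simp add: metrizes_weak_convergence_def)
  have "limitin weak_topology s Q F \<longleftrightarrow> ((\<lambda>n. on_carrier prob_measures d (s n) Q) \<longlongrightarrow> 0) F"
    using d s Q limitin_metric_dist_null[of s Q F] by (simp add: metrizes_weak_convergence_def)
  also have "\<dots> \<longleftrightarrow> ((\<lambda>n. d (s n) Q) \<longlongrightarrow> 0) F"
    using s Q by (intro tendsto_cong) (auto elim!: eventually_mono simp: on_carrier_def)
  finally show ?thesis .
qed

text \<open>By contradiction: along a subsequence on which the deviation probabilities of
  \<open>Z\<close> stay above some \<open>\<delta>\<close>, \<open>Y\<close> is made to shrink fast
  enough for Borel-Cantelli to give almost sure convergence, which the pathwise hypothesis hands
  over to \<open>Z\<close>.\<close>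

lemma tendsto_zero_in_prob_transfer:
  assumes "prob_space M"
    and Z: "\<And>n. n \<ge> 1 \<Longrightarrow> Z n \<in> borel_measurable M"
    and Y: "tendsto_zero_in_prob M Y"
    and YZ: "\<And>\<omega> r. \<omega> \<in> space M \<Longrightarrow> strict_mono r \<Longrightarrow> (\<lambda>n. Y (r n) \<omega>) \<longlonglongrightarrow> 0 \<Longrightarrow> (\<lambda>n. Z (r n) \<omega>) \<longlonglongrightarrow> 0"
  shows "tendsto_zero_in_prob M Z"
  unfolding tendsto_zero_in_prob_def
proof (intro conjI allI impI)
  interpret prob_space M by fact
  show "Z n \<in> borel_measurable M" if "1 \<le> n" for n using Z that by simp
  have Ym: "Y n \<in> borel_measurable M" if "1 \<le> n" for n
    using Y that by (simp add: tendsto_zero_in_prob_def)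
  fix \<epsilon> :: real assume "\<epsilon> > 0"
  let ?p = "\<lambda>n. measure M {\<omega> \<in> space M. \<bar>Z n \<omega>\<bar> > \<epsilon>}"
  let ?q = "\<lambda>n i. measure M {\<omega> \<in> space M. \<bar>Y n \<omega>\<bar> > (1/2)^i}"
  show "?p \<longlonglongrightarrow> 0"
  proof (rule ccontr)
    assume "\<not> ?p \<longlonglongrightarrow> 0"
    then obtain \<delta> where \<delta>: "\<delta> > 0" "\<And>N. \<exists>n\<ge>N. \<delta> \<le> ?p n"
      unfolding LIMSEQ_iff by (auto simp: not_less)
    \<comment> \<open>Demanding \<open>n > m\<close> makes the chosen subsequence strictly
      increasing; \<open>1 \<le> n\<close> keeps it where measurability is available.\<close>
    have ex: "\<exists>n>m. 1 \<le> n \<and> \<delta> \<le> ?p n \<and> ?q n i < (1/2)^i" for m i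
    proof -
      have "(\<lambda>n. ?q n i) \<longlonglongrightarrow> 0"
        using Y unfolding tendsto_zero_in_prob_def by simp
      then have "\<forall>\<^sub>F n in sequentially. ?q n i < (1/2)^i" by (rule order_tendstoD) simp
      then obtain N where N: "\<And>n. n \<ge> N \<Longrightarrow> ?q n i < (1/2)^i" by (auto simp: eventually_sequentially)
      obtain n where "n \<ge> max (Suc m) N" "\<delta> \<le> ?p n" using \<delta>(2) by blast
      then show ?thesis using N[of n] by (intro exI[of _ n]) auto
    qed
    have "\<exists>r. \<forall>i. (1 \<le> r i \<and> \<delta> \<le> ?p (r i) \<and> ?q (r i) i < (1/2)^i) \<and> r i < r (Suc i)"
      by (rule dependent_nat_choice) (use ex in blast)+
    then obtain r where r: "\<And>i. 1 \<le> r i" "\<And>i. \<delta> \<le> ?p (r i)" "\<And>i. ?q (r i) i < (1/2)^i"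
      and "strict_mono r" by (auto simp: strict_mono_Suc_iff)
    have "AE \<omega> in M. \<forall>\<^sub>F i in sequentially. \<omega> \<in> space M - {\<omega> \<in> space M. \<bar>Y (r i) \<omega>\<bar> > (1/2)^i}"
    proof (rule borel_cantelli_AE1)
      show "{\<omega> \<in> space M. \<bar>Y (r i) \<omega>\<bar> > (1/2)^i} \<in> sets M" for i
        using Ym[OF r(1)[of i]] by measurable
      show "summable (\<lambda>i. ?q (r i) i)"
        by (rule summable_comparison_test'[OF summable_geometric[of "1/2::real"], where N = 0])
           (use r(3) in \<open>auto intro: less_imp_le\<close>)
    qed (simp add: emeasure_eq_measure)
    moreover have "(\<lambda>i. Z (r i) \<omega>) \<longlonglongrightarrow> 0"
      if \<omega>: "\<omega> \<in> space M" "\<forall>\<^sub>F i in sequentially. \<omega> \<in> space M - {\<omega> \<in> space M. \<bar>Y (r i) \<omega>\<bar> > (1/2)^i}" for \<omega>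
    proof (rule YZ[OF \<omega>(1) \<open>strict_mono r\<close>])
      have "\<forall>\<^sub>F i in sequentially. norm (Y (r i) \<omega>) \<le> (1/2)^i"
        using \<omega>(2) by eventually_elim auto
      then show "(\<lambda>i. Y (r i) \<omega>) \<longlonglongrightarrow> 0"
        by (rule Lim_null_comparison) (intro LIMSEQ_power_zero, simp)
    qed
    ultimately have lim: "AE \<omega> in M. (\<lambda>i. Z (r i) \<omega>) \<longlonglongrightarrow> 0" by auto
    \<comment> \<open>Deviation probabilities are integrals of indicators that tend to 0 almost
      surely, so dominated convergence contradicts the lower bound \<open>\<delta>\<close>.\<close>
    let ?I = "\<lambda>i. indicator {\<omega> \<in> space M. \<bar>Z (r i) \<omega>\<bar> > \<epsilon>} :: 'a \<Rightarrow> real"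
    have S: "{\<omega> \<in> space M. \<bar>Z (r i) \<omega>\<bar> > \<epsilon>} \<in> sets M" for i
      using Z[OF r(1)[of i]] by measurable
    have "(\<lambda>i. \<integral>\<omega>. ?I i \<omega> \<partial>M) \<longlonglongrightarrow> (\<integral>\<omega>. 0 \<partial>M)"
    proof (rule integral_dominated_convergence[where w = "\<lambda>_. 1"])
      show "?I i \<in> borel_measurable M" for i using S by simp
      show "AE \<omega> in M. (\<lambda>i. ?I i \<omega>) \<longlonglongrightarrow> 0"
        using lim
      proof eventually_elim
        case (elim \<omega>)
        then have "\<forall>\<^sub>F i in sequentially. dist (Z (r i) \<omega>) 0 < \<epsilon>" using \<open>\<epsilon> > 0\<close> by (rule tendstoD)
        then have "\<forall>\<^sub>F i in sequentially. ?I i \<omega> = 0"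
          by eventually_elim (auto simp: indicator_def)
        then show ?case by (rule tendsto_eventually)
      qed
    qed (auto simp: indicator_def)
    then have "(\<lambda>i. ?p (r i)) \<longlonglongrightarrow> 0" using S by (simp add: Int_absorb2)
    then have "\<delta> \<le> 0" by (rule LIMSEQ_le_const) (use r(2) in blast)
    then show False using \<delta>(1) by simp
  qed
qed

section \<open>Consequences of metrization by the discrepancy\<close>

context bounded_rkhs
begin

text \<open>The embedding of a Dirac measure is a kernel function, so \<open>kdist\<close> is the
  discrepancy of Dirac measures and tends to 0 as the atoms merge.\<close>

lemma metrizes_imp_continuous_kernel:
  assumes "metrizes_weak_convergence (mmd H ip k)"
  shows "continuous_kernel k"
proof -
  have ret: "return borel x \<in> prob_measures" for x :: 'a
    by (simp add: space_prob_algebra prob_space_return)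
  have meas: "f \<in> borel_measurable borel" if "f \<in> H" for f using that H_measurable by blast
  have emb_ret: "emb (return borel x) = (\<lambda>y. k y x)" for x
    by (rule emb_eqI[OF kernel_mem]) (simp add: reproducing integral_return meas)
  have lim: "((\<lambda>x'. kdist x' x) \<longlongrightarrow> 0) (nhds x)" for x
  proof -
    have "((\<lambda>x'. \<integral>y. f y \<partial>return borel x') \<longlongrightarrow> (\<integral>y. f y \<partial>return borel x)) (nhds x)"
      if "continuous_on UNIV f" for f :: "'a \<Rightarrow> real"
    proof -
      have "(f \<longlongrightarrow> f x) (nhds x)"
        using that by (simp add: continuous_on_def flip: tendsto_at_iff_tendsto_nhds)
      then show ?thesis
        using borel_measurable_continuous_onI[OF that] by (simp add: integral_return)
    qed
    then have "limitin weak_topology (return borel) (return borel x) (nhds x)"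
      unfolding limitin_weak_topology by (simp add: ret)
    then have "((\<lambda>x'. mmd H ip k (return borel x') (return borel x)) \<longlongrightarrow> 0) (nhds x)"
      by (subst (asm) metrizes_limitin[OF assms]) (simp_all add: ret)
    then show ?thesis by (simp add: mmd_def emb_ret)
  qed
  \<comment> \<open>The arguments are moved one after the other; each move is controlled by
    \<open>eval_diff_bound\<close> for a kernel function, whose norm is at most
    \<open>kbound\<close>.\<close>
  have bound: "\<bar>k x' y' - k x y\<bar> \<le> kbound * kdist x' x + kbound * kdist y' y" for x x' y y'
  proof -
    have K: "nrm (\<lambda>z. k z x) \<le> kbound" for x using sqrt_kernel_le by (simp add: nrm_kernel)
    have "\<bar>k x' y' - k x y'\<bar> \<le> nrm (\<lambda>z. k z y') * kdist x' x"
      by (rule eval_diff_bound[OF kernel_mem])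
    also have "\<dots> \<le> kbound * kdist x' x" by (intro mult_right_mono K kdist_nonneg)
    finally have 1: "\<bar>k x' y' - k x y'\<bar> \<le> kbound * kdist x' x" .
    have "\<bar>k y' x - k y x\<bar> \<le> nrm (\<lambda>z. k z x) * kdist y' y"
      by (rule eval_diff_bound[OF kernel_mem])
    also have "\<dots> \<le> kbound * kdist y' y" by (intro mult_right_mono K kdist_nonneg)
    finally have "\<bar>k x y' - k x y\<bar> \<le> kbound * kdist y' y" by (simp add: kernel_commute)
    with 1 show ?thesis by linarith
  qed
  have "((\<lambda>(x', y'). k x' y') \<longlongrightarrow> k x y) (nhds (x, y))" for x y
  proof (rule LIM_zero_cancel, rule Lim_null_comparison)
    have "(fst \<longlongrightarrow> x) (nhds (x, y))" "(snd \<longlongrightarrow> y) (nhds (x, y))"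
      by (auto intro!: tendsto_eq_intros filterlim_ident)
    then have "((\<lambda>p. kbound * kdist (fst p) x + kbound * kdist (snd p) y) \<longlongrightarrow> kbound * 0 + kbound * 0) (nhds (x, y))"
      by (intro tendsto_intros filterlim_compose[OF lim])
    then show "((\<lambda>p. kbound * kdist (fst p) x + kbound * kdist (snd p) y) \<longlongrightarrow> 0) (nhds (x, y))" by simp
    show "\<forall>\<^sub>F p in nhds (x, y). norm ((case p of (x', y') \<Rightarrow> k x' y') - k x y)
        \<le> kbound * kdist (fst p) x + kbound * kdist (snd p) y"
      using bound by (intro always_eventually) (auto simp: split_beta)
  qed
  then show ?thesis
    by (auto simp: continuous_kernel_def continuous_on_def tendsto_at_iff_tendsto_nhds)
qed

text \<open>Measurability is shown first with one argument fixed in a countable dense set; the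
  triangle inequality through that set then covers two varying arguments.\<close>

lemma metric_measurable:
  fixes d :: "'a measure \<Rightarrow> 'a measure \<Rightarrow> real"
  assumes mmd: "metrizes_weak_convergence (mmd H ip k)" and d: "metrizes_weak_convergence d"
    and Q: "Q \<in> measurable N (prob_algebra borel)" and R: "R \<in> measurable N (prob_algebra borel)"
  shows "(\<lambda>\<omega>. d (Q \<omega>) (R \<omega>)) \<in> borel_measurable N"
proof -
  note cont = metrizes_imp_continuous_kernel[OF mmd]
  interpret K: Metric_space prob_measures "on_carrier prob_measures (mmd H ip k)"
    using mmd by (simp add: metrizes_weak_convergence_def)
  interpret D: Metric_space prob_measures "on_carrier prob_measures d"
    using d by (simp add: metrizes_weak_convergence_def)
  have top: "K.mtopology = D.mtopology"
    using mmd d by (simp add: metrizes_weak_convergence_def)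
  obtain S where S: "countable S" "S \<subseteq> prob_measures"
    and dense: "\<And>Q e. Q \<in> prob_measures \<Longrightarrow> e > 0 \<Longrightarrow> \<exists>R\<in>S. mmd H ip k Q R < e"
    using mmd_separable[OF cont] by metis
  have d_commute: "d Q R = d R Q" and d_triangle: "d Q R \<le> d Q T + d T R"
    if "Q \<in> prob_measures" "R \<in> prob_measures" "T \<in> prob_measures" for Q R T
    using D.commute[of Q R] D.triangle[of Q T R] that by (simp_all add: on_carrier_def)
  have K_ball: "W \<in> K.mball T r \<longleftrightarrow> T \<in> prob_measures \<and> W \<in> prob_measures \<and> mmd H ip k T W < r" for T W r
    unfolding K.in_mball by (auto simp: on_carrier_def)
  have D_ball: "W \<in> D.mball T r \<longleftrightarrow> T \<in> prob_measures \<and> W \<in> prob_measures \<and> d T W < r" for T W r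
    unfolding D.in_mball by (auto simp: on_carrier_def)
  \<comment> \<open>Both metrics have the same open sets, so each \<open>d\<close>-ball contains a
    discrepancy ball with the same centre, and density carries over.\<close>
  have d_dense: "\<exists>T\<in>S. d Q T < e" if Q: "Q \<in> prob_measures" and e: "e > 0" for Q e
  proof -
    have "openin K.mtopology (D.mball Q e)" unfolding top by simp
    moreover have "Q \<in> D.mball Q e" using Q e by simp
    ultimately obtain r where r: "r > 0" "K.mball Q r \<subseteq> D.mball Q e"
      unfolding K.openin_mtopology by blast
    obtain T where T: "T \<in> S" "mmd H ip k Q T < r" using dense[OF Q r(1)] by blast
    then have "T \<in> prob_measures" using S(2) by blast
    then have "T \<in> K.mball Q r" using T Q unfolding K_ball by blast
    then have "T \<in> D.mball Q e" using r(2) by blast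
    then have "d Q T < e" unfolding D_ball by blast
    then show ?thesis using T(1) by blast
  qed
  have open_meas: "{\<omega> \<in> space N. Q \<omega> \<in> U} \<in> sets N"
    if U: "openin K.mtopology U" and Q: "Q \<in> measurable N (prob_algebra borel)" for U Q
  proof -
    have Qp: "Q \<omega> \<in> prob_measures" if "\<omega> \<in> space N" for \<omega> using measurable_space[OF Q that] .
    \<comment> \<open>The balls indexed by \<open>G\<close> exhaust \<open>U\<close>, which writes
      the event as a countable union of sublevel sets of measurable functions.\<close>
    define G where "G = {p \<in> S \<times> (UNIV :: nat set). K.mball (fst p) (1 / Suc (snd p)) \<subseteq> U}"
    have "countable G" unfolding G_def using S(1) by (intro countable_Collect countable_SIGMA) auto
    have "{\<omega> \<in> space N. Q \<omega> \<in> U} = (\<Union>p\<in>G. {\<omega> \<in> space N. mmd H ip k (fst p) (Q \<omega>) < 1 / Suc (snd p)})"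
    proof (intro equalityI subsetI)
      fix \<omega> assume \<omega>: "\<omega> \<in> {\<omega> \<in> space N. Q \<omega> \<in> U}"
      then obtain r where r: "r > 0" "K.mball (Q \<omega>) r \<subseteq> U"
        using U unfolding K.openin_mtopology by blast
      \<comment> \<open>\<open>T\<close> lies within \<open>1 / Suc n\<close> of
        \<open>Q \<omega>\<close> and carries a ball of that radius, so twice the radius has to stay
        below \<open>r\<close>.\<close>
      obtain n where n: "1 / Suc n < r / 2"
        using reals_Archimedean[of "r / 2"] r(1) by (auto simp: inverse_eq_divide)
      obtain T where T: "T \<in> S" "mmd H ip k (Q \<omega>) T < 1 / Suc n"
        using dense[of "Q \<omega>" "1 / Suc n"] Qp \<omega> by auto
      have Tp: "T \<in> prob_measures" using T S by blast
      have TQ: "mmd H ip k T (Q \<omega>) < 1 / Suc n" using T mmd_commute[OF Tp Qp] \<omega> by simp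
      have "K.mball T (1 / Suc n) \<subseteq> K.mball (Q \<omega>) r"
      proof
        fix W assume W: "W \<in> K.mball T (1 / Suc n)"
        then have "W \<in> prob_measures" "mmd H ip k T W < 1 / Suc n" unfolding K_ball by auto
        then show "W \<in> K.mball (Q \<omega>) r"
          unfolding K_ball using mmd_triangle[of "Q \<omega>" T W] Qp \<omega> Tp T n by auto
      qed
      then have "(T, n) \<in> G" using T r by (auto simp: G_def)
      then show "\<omega> \<in> (\<Union>p\<in>G. {\<omega> \<in> space N. mmd H ip k (fst p) (Q \<omega>) < 1 / Suc (snd p)})"
        using TQ \<omega> by force
    next
      fix \<omega> assume "\<omega> \<in> (\<Union>p\<in>G. {\<omega> \<in> space N. mmd H ip k (fst p) (Q \<omega>) < 1 / Suc (snd p)})"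
      then obtain p where p: "p \<in> G" "\<omega> \<in> space N" "mmd H ip k (fst p) (Q \<omega>) < 1 / Suc (snd p)" by auto
      then have "fst p \<in> prob_measures" using S by (auto simp: G_def)
      then have "Q \<omega> \<in> K.mball (fst p) (1 / Suc (snd p))" unfolding K_ball using p Qp by auto
      then show "\<omega> \<in> {\<omega> \<in> space N. Q \<omega> \<in> U}" using p by (auto simp: G_def)
    qed
    also have "\<dots> \<in> sets N"
    proof (rule sets.countable_UN''[OF \<open>countable G\<close>])
      fix p assume "p \<in> G"
      then have "fst p \<in> prob_measures" using S by (auto simp: G_def)
      then have "(\<lambda>\<omega>. mmd H ip k (fst p) (Q \<omega>)) \<in> borel_measurable N"
        by (intro mmd_measurable cont Q measurable_const)
      then show "{\<omega> \<in> space N. mmd H ip k (fst p) (Q \<omega>) < 1 / Suc (snd p)} \<in> sets N" by measurable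
    qed
    finally show ?thesis .
  qed
  have dist_meas: "(\<lambda>\<omega>. d T (Q \<omega>)) \<in> borel_measurable N"
    if T: "T \<in> S" and Q: "Q \<in> measurable N (prob_algebra borel)" for T Q
    unfolding borel_measurable_iff_less
  proof
    fix r
    have "{\<omega> \<in> space N. d T (Q \<omega>) < r} = {\<omega> \<in> space N. Q \<omega> \<in> D.mball T r}"
      unfolding D_ball using T S measurable_space[OF Q] by auto
    then show "{\<omega> \<in> space N. d T (Q \<omega>) < r} \<in> sets N"
      using open_meas[OF _ Q, of "D.mball T r"] by (simp add: top)
  qed
  show ?thesis
    unfolding borel_measurable_iff_less
  proof
    fix r
    have "{\<omega> \<in> space N. d (Q \<omega>) (R \<omega>) < r} = (\<Union>T\<in>S. {\<omega> \<in> space N. d T (Q \<omega>) + d T (R \<omega>) < r})"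
    proof (intro equalityI subsetI)
      fix \<omega> assume \<omega>: "\<omega> \<in> {\<omega> \<in> space N. d (Q \<omega>) (R \<omega>) < r}"
      then have p: "Q \<omega> \<in> prob_measures" "R \<omega> \<in> prob_measures"
        using measurable_space[OF Q] measurable_space[OF R] by auto
      \<comment> \<open>Half of the gap suffices, since the detour over \<open>T\<close> adds at
        most \<open>2 * d (Q \<omega>) T\<close>.\<close>
      then obtain T where T: "T \<in> S" "d (Q \<omega>) T < (r - d (Q \<omega>) (R \<omega>)) / 2"
        using d_dense[of "Q \<omega>" "(r - d (Q \<omega>) (R \<omega>)) / 2"] \<omega> by auto
      then have Tp: "T \<in> prob_measures" using S by blast
      have "d T (Q \<omega>) + d T (R \<omega>) < r"
        using T(2) d_commute[of T "Q \<omega>" T] d_triangle[of T "R \<omega>" "Q \<omega>"] p Tp by auto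
      then show "\<omega> \<in> (\<Union>T\<in>S. {\<omega> \<in> space N. d T (Q \<omega>) + d T (R \<omega>) < r})" using T(1) \<omega> by blast
    next
      fix \<omega> assume "\<omega> \<in> (\<Union>T\<in>S. {\<omega> \<in> space N. d T (Q \<omega>) + d T (R \<omega>) < r})"
      then obtain T where T: "T \<in> S" "\<omega> \<in> space N" "d T (Q \<omega>) + d T (R \<omega>) < r" by auto
      then have p: "Q \<omega> \<in> prob_measures" "R \<omega> \<in> prob_measures" "T \<in> prob_measures"
        using measurable_space[OF Q] measurable_space[OF R] S by auto
      have "d (Q \<omega>) (R \<omega>) < r"
        using T(3) d_commute[of T "Q \<omega>" T] d_triangle[of "Q \<omega>" "R \<omega>" T] p by auto
      then show "\<omega> \<in> {\<omega> \<in> space N. d (Q \<omega>) (R \<omega>) < r}" using T(2) by blast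
    qed
    also have "\<dots> \<in> sets N"
    proof (rule sets.countable_UN''[OF S(1)])
      fix T assume "T \<in> S"
      then have [measurable]: "(\<lambda>\<omega>. d T (Q \<omega>)) \<in> borel_measurable N" "(\<lambda>\<omega>. d T (R \<omega>)) \<in> borel_measurable N"
        by (intro dist_meas Q R; assumption)+
      show "{\<omega> \<in> space N. d T (Q \<omega>) + d T (R \<omega>) < r} \<in> sets N" by measurable
    qed
    finally show "{\<omega> \<in> space N. d (Q \<omega>) (R \<omega>) < r} \<in> sets N" .
  qed
qed

end

section \<open>The two implications, first for a fixed outcome, then in both modes of
  convergence\<close>

theorem theorem4p1:
  fixes M :: "'w measure"
    and X :: "nat \<Rightarrow> 'w \<Rightarrow> 'a::polish_space"
    and P :: "'w \<Rightarrow> 'a measure"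
    and d :: "'a measure \<Rightarrow> 'a measure \<Rightarrow> real"
    and H :: "('a \<Rightarrow> real) set"
    and ip :: "('a \<Rightarrow> real) \<Rightarrow> ('a \<Rightarrow> real) \<Rightarrow> real"
    and k :: "'a \<Rightarrow> 'a \<Rightarrow> real"
  assumes "complete_standard_borel_prob M"
    and "\<And>n. n \<ge> 1 \<Longrightarrow> X n \<in> borel_measurable M"
    and "metrizes_weak_convergence d"
    and "rkhs H ip k"
    and "H \<subseteq> borel_measurable borel"
    and "bounded_kernel k"
    and "random_measure M P"
  shows "(continuous_kernel k \<longrightarrow>
            (ewc_in_prob_with_limit M d X P \<longrightarrow>
               tendsto_zero_in_prob M (embedding_error H ip k X P)) \<and>
            (ewc_as_with_limit M d X P \<longrightarrow>
               tendsto_zero_as M (embedding_error H ip k X P))) \<and>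
         (metrizes_weak_convergence (mmd H ip k) \<longrightarrow>
            (tendsto_zero_in_prob M (embedding_error H ip k X P) \<longrightarrow> ewc_in_prob M d X) \<and>
            (tendsto_zero_as M (embedding_error H ip k X P) \<longrightarrow> ewc_as M d X))"
proof -
  interpret bounded_rkhs H ip k
    using assms(4-6) by (simp add: bounded_rkhs_def bounded_rkhs_axioms_def)
  have M: "prob_space M"
    using assms(1) prob_space.prob_space_completion by (auto simp: complete_standard_borel_prob_def)
  have Pm: "P \<in> measurable M (prob_algebra borel)"
    using assms(7) by (simp add: random_measure_def)
  have Pp: "P \<omega> \<in> prob_measures" if "\<omega> \<in> space M" for \<omega>
    using measurable_space[OF Pm that] .
  have Em: "empirical_measure X n \<in> measurable M (prob_algebra borel)" if "n \<ge> 1" for n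
    using empirical_measure_measurable[of X M n] assms(2) that by blast
  let ?D = "\<lambda>n \<omega>. d (empirical_measure X n \<omega>) (P \<omega>)"
  let ?E = "embedding_error H ip k X P"
  \<comment> \<open>A strictly increasing index sequence leaves the meaningless index 0
    behind.\<close>
  have ev_pos: "\<forall>\<^sub>F n in sequentially. 1 \<le> r n" if "strict_mono r" for r :: "nat \<Rightarrow> nat"
    using seq_suble[OF that] by (intro eventually_sequentiallyI[of 1]) (meson order_trans)
  have ev_prob: "\<forall>\<^sub>F n in sequentially. empirical_measure X (r n) \<omega> \<in> prob_measures"
    if "strict_mono r" for r \<omega>
    using ev_pos[OF that] by eventually_elim (rule empirical_measure_prob)
  have E_iff: "(\<lambda>n. ?E (r n) \<omega>) \<longlonglongrightarrow> 0 \<longleftrightarrow>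
      (\<lambda>n. mmd H ip k (empirical_measure X (r n) \<omega>) (P \<omega>)) \<longlonglongrightarrow> 0" if "strict_mono r" for r \<omega>
    by (intro tendsto_cong eventually_mono[OF ev_pos[OF that]] embedding_error_eq_mmd)
  \<comment> \<open>The implication is deterministic for a fixed outcome and subsequence, the form
    that \<open>tendsto_zero_in_prob_transfer\<close> asks for.\<close>
  have forward: "(\<lambda>n. ?E (r n) \<omega>) \<longlonglongrightarrow> 0"
    if cont: "continuous_kernel k" and \<omega>: "\<omega> \<in> space M" and r: "strict_mono r"
      and D: "(\<lambda>n. ?D (r n) \<omega>) \<longlonglongrightarrow> 0" for \<omega> r
  proof -
    have "limitin weak_topology (\<lambda>n. empirical_measure X (r n) \<omega>) (P \<omega>) sequentially"
      using metrizes_limitin[OF assms(3) ev_prob[OF r] Pp[OF \<omega>]] D by blast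
    then show ?thesis
      unfolding E_iff[OF r] limitin_weak_topology by (intro mmd_tendsto_zero[OF cont]) auto
  qed
  have backward: "(\<lambda>n. ?D (r n) \<omega>) \<longlonglongrightarrow> 0"
    if mmd: "metrizes_weak_convergence (mmd H ip k)" and \<omega>: "\<omega> \<in> space M" and r: "strict_mono r"
      and E: "(\<lambda>n. ?E (r n) \<omega>) \<longlonglongrightarrow> 0" for \<omega> r
    using metrizes_limitin[OF mmd ev_prob[OF r] Pp[OF \<omega>]] metrizes_limitin[OF assms(3) ev_prob[OF r] Pp[OF \<omega>]]
      E E_iff[OF r] by blast
  have Emeas: "?E n \<in> borel_measurable M" if "continuous_kernel k" "n \<ge> 1" for n
  proof -
    have "?E n = (\<lambda>\<omega>. mmd H ip k (empirical_measure X n \<omega>) (P \<omega>))"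
      by (rule ext) (rule embedding_error_eq_mmd[OF that(2)])
    then show ?thesis by (simp only: mmd_measurable[OF that(1) Em[OF that(2)] Pm])
  qed
  \<comment> \<open>The almost sure versions use the pathwise implications along the full
    sequence.\<close>
  have mono_id: "strict_mono (\<lambda>n::nat. n)" by (simp add: strict_mono_def)
  show ?thesis
  proof (intro conjI impI)
    assume cont: "continuous_kernel k"
    show "tendsto_zero_in_prob M ?E" if "ewc_in_prob_with_limit M d X P"
    proof (rule tendsto_zero_in_prob_transfer[OF M Emeas[OF cont]])
      show "tendsto_zero_in_prob M ?D" using that by (simp only: ewc_in_prob_with_limit_def)
    qed (assumption, rule forward[OF cont])
    show "tendsto_zero_as M ?E" if "ewc_as_with_limit M d X P"
    proof -
      have "AE \<omega> in M. (\<lambda>n. ?D n \<omega>) \<longlonglongrightarrow> 0"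
        using that by (simp add: ewc_as_with_limit_def tendsto_zero_as_def)
      then show ?thesis
        unfolding tendsto_zero_as_def using AE_space by eventually_elim (rule forward[OF cont _ mono_id])
    qed
  next
    assume mmd: "metrizes_weak_convergence (mmd H ip k)"
    show "ewc_in_prob M d X" if "tendsto_zero_in_prob M ?E"
    proof -
      have "tendsto_zero_in_prob M ?D"
        by (rule tendsto_zero_in_prob_transfer[OF M metric_measurable[OF mmd assms(3) Em Pm] that])
           (assumption, rule backward[OF mmd])
      \<comment> \<open>\<open>P\<close> itself serves as the limit measure.\<close>
      then show ?thesis
        using assms(7) unfolding ewc_in_prob_def ewc_in_prob_with_limit_def by blast
    qed
    show "ewc_as M d X" if "tendsto_zero_as M ?E"
    proof -
      have "AE \<omega> in M. (\<lambda>n. ?D n \<omega>) \<longlonglongrightarrow> 0"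
        using that[unfolded tendsto_zero_as_def] AE_space by eventually_elim (rule backward[OF mmd _ mono_id])
      then show ?thesis
        using assms(7) by (auto simp: ewc_as_def ewc_as_with_limit_def tendsto_zero_as_def)
    qed
  qed
qed

end
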